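(* Let $R$ be a Noetherian domain. The following are equivalent: (1) $R$ is a Jacobson domain. (2) For all $N\in\mathbb{N}$ and $f_0,f_1,\dots,f_n\in R[X]=R[X_1,\dots,X_N]$, if $$f_0(a)\in\sqrt{\bigl(f_1(a),\dots,f_n(a)\bigr)\widetilde{R}}\quad\text{for all } a\in\widetilde{R}^N,$$ then $f_0\in\sqrt{(f_1,\dots,f_n)R[X]}$. (3) For polynomials $f_1,\dots,f_n\in R[X]$ in the single indeterminate $X$, if $$1\in\bigl(f_1(a),\dots,f_n(a)\bigr)\widetilde{R}\quad\text{for all } a\in\widetilde{R},$$ then $1\in(f_1,\dots,f_n)R[X]$.
   Context: A Jacobson ring is a (commutative) ring each of whose prime ideals is an intersection of maximal ideals; a Jacobson domain is a Jacobson ring which is an integral domain. For a domain $R$, $\widetilde{R}$ denotes the integral closure of $R$ in an algebraic closure of the fraction field of $R$. For an ideal $I$ of a ring $S$, $\sqrt{I}=\{r\in S : r^k\in I\text{ for some }k>0\}$. *)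

theory Defs
  imports
    "HOL-Computational_Algebra.Computational_Algebra"
    "HOL-Algebra.Algebraic_Closure_Type"
    "HOL-Library.Poly_Mapping"
begin

text \<open>
  A commutative ring is given by a type \<open>'a\<close> of class \<open>comm_ring_1\<close> or \<open>idom\<close>, and its ideals are
  those of the HOL-Algebra record \<open>ring_of_type_algebra\<close>. A subring is obtained by
  restricting the carrier of this record.
\<close>

definition jacobson_ring :: "('a, 'b) ring_scheme \<Rightarrow> bool" where
  "jacobson_ring R \<longleftrightarrow> cring R \<and>
     (\<forall>P. primeideal P R \<longrightarrow> (\<exists>F \<subseteq> {M. maximalideal M R}. P = carrier R \<inter> \<Inter>F))"

definition jacobson_domain :: "('a, 'b) ring_scheme \<Rightarrow> bool" where
  "jacobson_domain R \<longleftrightarrow> jacobson_ring R \<and> domain R"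

definition ideal_radical :: "('a, 'b) ring_scheme \<Rightarrow> 'a set \<Rightarrow> 'a set" where
  "ideal_radical S I = {r \<in> carrier S. \<exists>k::nat. k > 0 \<and> r [^]\<^bsub>S\<^esub> k \<in> I}"

definition to_closure :: "'a::idom \<Rightarrow> 'a fract alg_closure" where
  "to_closure r = to_ac (to_fract r)"

definition upoly_eval :: "'a::idom poly \<Rightarrow> 'a fract alg_closure \<Rightarrow> 'a fract alg_closure" where
  "upoly_eval p a = poly (map_poly to_closure p) a"

text \<open>
  The ring $\widetilde{R}$: the integral closure of the domain in the algebraic closure of its
  fraction field.
\<close>

definition integral_closure :: "'a::idom fract alg_closure set" where
  "integral_closure =
     {x. \<exists>p :: 'a poly. Polynomial.lead_coeff p = 1 \<and> upoly_eval p x = 0}"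

definition integral_closure_ring :: "'a::idom fract alg_closure ring" where
  "integral_closure_ring = ring_of_type_algebra\<lparr>carrier := integral_closure\<rparr>"

text \<open>
  Polynomials over \<open>'a\<close> in the indeterminates $X_0, X_1, \ldots$ are finitely supported functions
  from exponent vectors to coefficients, with the convolution product of \<open>Poly_Mapping\<close>. The ring
  \<open>mpoly_ring N\<close> is the subring of polynomials in $X_0, \ldots, X_{N-1}$ only.
\<close>

type_synonym 'a mpoly = "(nat \<Rightarrow>\<^sub>0 nat) \<Rightarrow>\<^sub>0 'a"

definition mpoly_ring :: "nat \<Rightarrow> 'a::comm_ring_1 mpoly ring" where
  "mpoly_ring N = ring_of_type_algebra
     \<lparr>carrier := {p. \<forall>m \<in> Poly_Mapping.keys p. Poly_Mapping.keys m \<subseteq> {..<N}}\<rparr>"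

definition mpoly_eval :: "'a::idom mpoly \<Rightarrow> (nat \<Rightarrow> 'a fract alg_closure) \<Rightarrow> 'a fract alg_closure" where
  "mpoly_eval p a = (\<Sum>m \<in> Poly_Mapping.keys p.
     to_closure (Poly_Mapping.lookup p m) *
     (\<Prod>i \<in> Poly_Mapping.keys m. a i ^ Poly_Mapping.lookup m i))"

end

theory Submission
  imports Defs "Jordan_Normal_Form.Char_Poly"
begin

text \<open>
  Write \<open>R\<close> for the type \<open>'a\<close> and \<open>T\<close> for its integral closure in an algebraic closure of the
  fraction field. The three conditions imply each other in a circle.

  Suppose that \<open>R\<close> is a Jacobson ring and that \<open>f\<^sub>0\<close> is not in the radical of \<open>(f\<^sub>1, \<dots>, f\<^sub>n)\<close>. Then
  some prime \<open>Q\<close> of the polynomial ring contains \<open>f\<^sub>1, \<dots>, f\<^sub>n\<close> but not \<open>f\<^sub>0\<close>. Eliminating one variable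
  after the other (\<open>hom_extends_to_adjoined_element\<close>, \<open>specialization_avoiding\<close>) produces \<open>r \<in> R\<close>
  outside \<open>Q\<close> such that every homomorphism from \<open>R\<close> to an algebraically closed field that kills the
  contraction of \<open>Q\<close> but not \<open>r\<close> extends to the polynomial ring, killing \<open>Q\<close> but not \<open>f\<^sub>0\<close>. The
  Jacobson property provides a maximal ideal \<open>m\<close> over this contraction with \<open>r \<notin> m\<close>, and \<open>m\<close> lies
  under a maximal ideal \<open>M\<close> of \<open>T\<close> (\<open>maximal_lying_over\<close>). The field \<open>T/M\<close> is algebraically closed,
  because monic polynomials over \<open>T\<close> have roots in \<open>T\<close>. Hence \<open>R \<rightarrow> T/M\<close> extends, and the extension
  is the evaluation at a point of \<open>T/M\<close>. A lift of this point to \<open>T\<close> makes \<open>f\<^sub>1, \<dots>, f\<^sub>n\<close> take values in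
  \<open>M\<close> while the value of \<open>f\<^sub>0\<close> is outside \<open>M\<close>, against the pointwise hypothesis.

  The univariate condition is the multivariate one for \<open>N = 1\<close> and \<open>f\<^sub>0 = 1\<close>.

  If finally \<open>R\<close> is Noetherian but not Jacobson, there are a prime \<open>P\<close> and \<open>r \<notin> P\<close> such that \<open>r\<close> is in
  every maximal ideal over \<open>P\<close>. Maximal ideals of \<open>T\<close> contract to maximal ideals of \<open>R\<close>
  (\<open>maximal_contraction\<close>), so generators of \<open>P\<close> and \<open>r X - 1\<close> satisfy the pointwise hypothesis of the
  univariate condition, but they generate the unit ideal only if \<open>r \<in> P\<close>.

  The facts about \<open>T\<close>, namely that it is a ring, integrally closed, and has lying over, all come from
  the determinant trick in \<open>monic_root_of_multiplier\<close>.
\<close>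

hide_const (open) UnivPoly.coeff UnivPoly.monom Polynomials.degree Polynomials.lead_coeff
  Module.smult Coset.order up_ring.coeff up_ring.monom

section \<open>Ideals of subrings as sets\<close>

text \<open>
  The rings in play are the type \<open>'a\<close>, its polynomial rings, the subrings \<open>mpoly_ring N\<close> and the
  integral closure. All of them are sets closed under the operations of some type, so ring
  arguments are carried out with type class arithmetic on such sets, and only the statements that
  mention \<open>ring_of_type_algebra\<close> are translated. Residue rings are not formed: a quotient by an
  ideal that is chosen inside a proof is not a type, and calculations modulo an ideal take its place.
\<close>

locale subring_set =
  fixes A :: "'r::comm_ring_1 set"
  assumes one_closed: "1 \<in> A"
    and diff_closed: "x \<in> A \<Longrightarrow> y \<in> A \<Longrightarrow> x - y \<in> A"
    and mult_closed: "x \<in> A \<Longrightarrow> y \<in> A \<Longrightarrow> x * y \<in> A"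
begin

lemma zero_closed: "0 \<in> A"
  using diff_closed[OF one_closed one_closed] by simp

lemma minus_closed: "x \<in> A \<Longrightarrow> - x \<in> A"
  using diff_closed[OF zero_closed] by fastforce

lemma add_closed: "x \<in> A \<Longrightarrow> y \<in> A \<Longrightarrow> x + y \<in> A"
  using diff_closed[OF _ minus_closed] by fastforce

lemma power_closed: "x \<in> A \<Longrightarrow> x ^ n \<in> A"
  by (induction n) (auto intro: one_closed mult_closed)

lemma sum_closed: "(\<And>i. i \<in> K \<Longrightarrow> f i \<in> A) \<Longrightarrow> sum f K \<in> A"
  by (induction K rule: infinite_finite_induct) (auto intro: zero_closed add_closed)

lemma prod_closed: "(\<And>i. i \<in> K \<Longrightarrow> f i \<in> A) \<Longrightarrow> prod f K \<in> A"
  by (induction K rule: infinite_finite_induct) (auto intro: one_closed mult_closed)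

lemmas closed = one_closed diff_closed mult_closed zero_closed minus_closed add_closed
  power_closed sum_closed prod_closed

end

lemma subring_set_UNIV: "subring_set UNIV"
  by unfold_locales auto

locale ideal_set = subring_set A for A :: "'r::comm_ring_1 set" +
  fixes I :: "'r set"
  assumes subset: "I \<subseteq> A"
    and zero_mem: "0 \<in> I"
    and add_mem: "x \<in> I \<Longrightarrow> y \<in> I \<Longrightarrow> x + y \<in> I"
    and absorb: "a \<in> A \<Longrightarrow> x \<in> I \<Longrightarrow> a * x \<in> I"
begin

lemma in_ring: "x \<in> I \<Longrightarrow> x \<in> A"
  using subset by blast

lemma absorb_right: "x \<in> I \<Longrightarrow> a \<in> A \<Longrightarrow> x * a \<in> I"
  using absorb by (simp add: mult.commute)

lemma minus_mem: "x \<in> I \<Longrightarrow> - x \<in> I"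
  using absorb[OF minus_closed[OF one_closed]] by fastforce

lemma diff_mem: "x \<in> I \<Longrightarrow> y \<in> I \<Longrightarrow> x - y \<in> I"
  using add_mem[OF _ minus_mem] by fastforce

lemma diff_commute: "x - y \<in> I \<Longrightarrow> y - x \<in> I"
  using minus_mem by fastforce

lemma sum_mem: "(\<And>i. i \<in> K \<Longrightarrow> f i \<in> I) \<Longrightarrow> sum f K \<in> I"
  by (induction K rule: infinite_finite_induct) (auto intro: zero_mem add_mem)

lemma mem_cong: "x - y \<in> I \<Longrightarrow> x \<in> I \<longleftrightarrow> y \<in> I"
  using add_mem[of "x - y" y] diff_mem[of x "x - y"] by auto

end

locale prime_set = ideal_set +
  assumes one_notin: "1 \<notin> I"
    and prime: "x \<in> A \<Longrightarrow> y \<in> A \<Longrightarrow> x * y \<in> I \<Longrightarrow> x \<in> I \<or> y \<in> I"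
begin

lemma power_notin: "x \<in> A \<Longrightarrow> x \<notin> I \<Longrightarrow> x ^ k \<notin> I"
  by (induction k) (auto simp: one_notin dest: prime[OF _ power_closed])

end

text \<open>
  Maximality is expressed by invertibility modulo the ideal, the form in which it is used; the
  equivalence with maximality among proper ideals is \<open>maximalideal_iff\<close> below.
\<close>

locale maximal_set = ideal_set +
  assumes proper: "1 \<notin> I"
    and inverse_mod: "c \<in> A \<Longrightarrow> c \<notin> I \<Longrightarrow> \<exists>u\<in>A. u * c - 1 \<in> I"

sublocale maximal_set \<subseteq> prime_set
proof
  show "1 \<notin> I" by (rule proper)
  fix x y assume xy: "x \<in> A" "y \<in> A" "x * y \<in> I"
  show "x \<in> I \<or> y \<in> I"
  proof (rule disjCI)
    assume "y \<notin> I"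
    then obtain u where u: "u \<in> A" "u * y - 1 \<in> I"
      using inverse_mod xy by blast
    have "u * (x * y) - x * (u * y - 1) \<in> I"
      using u xy by (intro diff_mem) (auto intro: absorb)
    then show "x \<in> I" by (simp add: algebra_simps)
  qed
qed

abbreviation ring_on :: "'r::comm_ring_1 set \<Rightarrow> 'r ring" where
  "ring_on A \<equiv> ring_of_type_algebra\<lparr>carrier := A\<rparr>"

lemma ring_on_UNIV: "ring_on UNIV = ring_of_type_algebra"
  by (simp add: ring_of_type_algebra_def)

lemma ring_on_sel [simp]:
  "carrier (ring_on A) = A" "\<zero>\<^bsub>ring_on A\<^esub> = 0" "\<one>\<^bsub>ring_on A\<^esub> = 1"
  "x \<otimes>\<^bsub>ring_on A\<^esub> y = x * y" "x \<oplus>\<^bsub>ring_on A\<^esub> y = x + y"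
  by (simp_all add: ring_of_type_algebra_def)

lemma ring_of_type_algebra_sel [simp]:
  "\<zero>\<^bsub>ring_of_type_algebra\<^esub> = 0" "\<one>\<^bsub>ring_of_type_algebra\<^esub> = 1"
  "x \<otimes>\<^bsub>ring_of_type_algebra\<^esub> y = x * y" "x \<oplus>\<^bsub>ring_of_type_algebra\<^esub> y = x + y"
  by (simp_all add: ring_of_type_algebra_def)

lemma pow_ring_on [simp]: "x [^]\<^bsub>ring_on A\<^esub> (k::nat) = x ^ k"
  by (induction k) (simp_all add: mult.commute)

context subring_set
begin

lemma cring_ring_on: "cring (ring_on A)"
proof -
  have "\<exists>y\<in>A. y + x = 0" if "x \<in> A" for x
    using minus_closed[OF that] by (intro bexI[of _ "- x"]) auto
  then show ?thesis
    by (intro cringI abelian_groupI comm_monoidI) (auto simp: algebra_simps closed)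
qed

lemma ideal_iff: "ideal I (ring_on A) \<longleftrightarrow> ideal_set A I"
proof
  assume "ideal I (ring_on A)"
  then interpret I: ideal I "ring_on A" .
  show "ideal_set A I"
    using I.Icarr I.I_l_closed additive_subgroup.zero_closed[OF I.is_additive_subgroup]
      additive_subgroup.a_closed[OF I.is_additive_subgroup]
    by unfold_locales auto
next
  assume "ideal_set A I"
  then interpret I: ideal_set A I .
  interpret R: cring "ring_on A" by (rule cring_ring_on)
  have inv: "\<ominus>\<^bsub>ring_on A\<^esub> x = - x" if "x \<in> A" for x
    using that by (intro R.minus_equality) (auto simp: minus_closed)
  show "ideal I (ring_on A)"
  proof (rule idealI)
    show "ring (ring_on A)" by (rule R.ring_axioms)
    have "inv\<^bsub>add_monoid (ring_on A)\<^esub> x \<in> I" if "x \<in> I" for x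
      using inv[of x] I.minus_mem[OF that] I.in_ring[OF that] by (simp only: a_inv_def)
    then show "subgroup I (add_monoid (ring_on A))"
      by (intro subgroup.intro) (auto simp: I.zero_mem I.add_mem I.in_ring)
  qed (auto intro: I.absorb I.absorb_right)
qed

lemma primeideal_iff: "primeideal P (ring_on A) \<longleftrightarrow> prime_set A P"
proof
  assume "primeideal P (ring_on A)"
  then interpret P: primeideal P "ring_on A" .
  interpret ideal_set A P using P.is_ideal ideal_iff by blast
  have "1 \<notin> P" using P.I_notcarr P.one_imp_carrier by auto
  then show "prime_set A P" using P.I_prime by unfold_locales auto
next
  assume "prime_set A P"
  then interpret P: prime_set A P .
  show "primeideal P (ring_on A)"
    using P.prime P.one_notin one_closed cring_ring_on
    by (intro primeidealI) (auto simp: ideal_iff P.ideal_set_axioms)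
qed

lemma ideal_set_add_principal:
  assumes "ideal_set A I" "c \<in> A"
  shows "ideal_set A {x + a * c | x a. x \<in> I \<and> a \<in> A}" (is "ideal_set A ?J")
proof -
  interpret I: ideal_set A I by fact
  show ?thesis
  proof
    show "?J \<subseteq> A" using assms(2) by (auto simp: closed I.in_ring)
    show "0 \<in> ?J" using I.zero_mem zero_closed by force
    show "x + y \<in> ?J" if "x \<in> ?J" "y \<in> ?J" for x y
    proof -
      obtain i a i' a' where "x = i + a * c" "y = i' + a' * c" "i \<in> I" "i' \<in> I" "a \<in> A" "a' \<in> A"
        using \<open>x \<in> ?J\<close> \<open>y \<in> ?J\<close> by auto
      then show ?thesis
        by (intro CollectI exI[of _ "i + i'"] exI[of _ "a + a'"])
          (auto simp: I.add_mem add_closed algebra_simps)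
    qed
    show "b * x \<in> ?J" if "b \<in> A" "x \<in> ?J" for b x
    proof -
      obtain i a where "x = i + a * c" "i \<in> I" "a \<in> A" using \<open>x \<in> ?J\<close> by auto
      then show ?thesis using \<open>b \<in> A\<close>
        by (intro CollectI exI[of _ "b * i"] exI[of _ "b * a"])
          (auto simp: I.absorb mult_closed algebra_simps)
    qed
  qed
qed

lemma maximalideal_iff: "maximalideal M (ring_on A) \<longleftrightarrow> maximal_set A M"
proof
  assume "maximalideal M (ring_on A)"
  then interpret M: maximalideal M "ring_on A" .
  interpret ideal_set A M using M.is_ideal ideal_iff by blast
  show "maximal_set A M"
  proof
    show "1 \<notin> M" using M.I_notcarr M.one_imp_carrier by auto
    fix c assume c: "c \<in> A" "c \<notin> M"
    define J where "J = {x + a * c | x a. x \<in> M \<and> a \<in> A}"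
    have J: "ideal_set A J"
      unfolding J_def by (rule ideal_set_add_principal[OF ideal_set_axioms c(1)])
    have MJ: "M \<subseteq> J" using zero_closed by (force simp: J_def)
    have "c \<in> J" using zero_mem one_closed by (force simp: J_def)
    then have "J \<noteq> M" using c(2) by blast
    then have "J = A"
      using M.I_maximal[of J] J MJ ideal_set.subset[OF J] by (simp add: ideal_iff)
    then have "1 \<in> J" using one_closed by simp
    then obtain x a where xa: "1 = x + a * c" "x \<in> M" "a \<in> A" unfolding J_def by blast
    have "a * c - 1 = - x" by (subst xa(1)) simp
    then show "\<exists>u\<in>A. u * c - 1 \<in> M"
      using minus_mem[OF xa(2)] xa(3) by (intro bexI[of _ a]) simp_all
  qed
next
  assume "maximal_set A M"
  then interpret M: maximal_set A M .
  show "maximalideal M (ring_on A)"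
  proof (rule maximalidealI)
    show "ideal M (ring_on A)" by (simp add: ideal_iff M.ideal_set_axioms)
    show "carrier (ring_on A) \<noteq> M" using M.proper one_closed by auto
    fix J assume "ideal J (ring_on A)" and MJ: "M \<subseteq> J"
    then interpret J: ideal_set A J by (simp add: ideal_iff)
    have "J = A" if "J \<noteq> M"
    proof -
      obtain c where c: "c \<in> J" "c \<notin> M" using \<open>J \<noteq> M\<close> MJ by blast
      then obtain u where "u \<in> A" "u * c - 1 \<in> M" using M.inverse_mod J.in_ring by blast
      then have "1 \<in> J" using J.absorb[OF _ c(1)] MJ J.mem_cong[of "u * c" 1] by blast
      then show ?thesis using J.absorb[of _ 1] J.subset by auto
    qed
    then show "J = M \<or> J = carrier (ring_on A)" by auto
  qed
qed

lemma genideal_iff: "x \<in> Idl\<^bsub>ring_on A\<^esub> S \<longleftrightarrow> (\<forall>I. ideal_set A I \<longrightarrow> S \<subseteq> I \<longrightarrow> x \<in> I)"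
  by (auto simp: genideal_def ideal_iff)

lemma ideal_set_genideal: "S \<subseteq> A \<Longrightarrow> ideal_set A (Idl\<^bsub>ring_on A\<^esub> S)"
  using ring.genideal_ideal[OF cring.axioms(1)[OF cring_ring_on]] by (simp add: ideal_iff)

lemma genideal_superset: "S \<subseteq> Idl\<^bsub>ring_on A\<^esub> S"
  by (auto simp: genideal_def)

text \<open>
  Krull's construction: an ideal that is maximal among those disjoint from a multiplicative set \<open>W\<close>
  is prime. The last conclusion records the maximality. With \<open>W\<close> the powers of an element it yields
  primes outside a radical, with \<open>W = {1}\<close> maximal ideals.
\<close>

lemma exists_prime_avoiding:
  assumes I: "ideal_set A I" and W: "W \<subseteq> A" "1 \<in> W" "\<And>x y. x \<in> W \<Longrightarrow> y \<in> W \<Longrightarrow> x * y \<in> W"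
    and disj: "I \<inter> W = {}"
  obtains P where "prime_set A P" "I \<subseteq> P" "P \<inter> W = {}"
    "\<forall>c\<in>A - P. \<exists>p\<in>P. \<exists>a\<in>A. p + a * c \<in> W"
proof -
  define F where "F = {J. ideal_set A J \<and> I \<subseteq> J \<and> J \<inter> W = {}}"
  have "\<exists>P\<in>F. \<forall>J\<in>F. P \<subseteq> J \<longrightarrow> J = P"
  proof (rule subset_Zorn_nonempty)
    show "F \<noteq> {}" using I disj by (auto simp: F_def)
    fix C assume C: "C \<noteq> {}" "subset.chain F C"
    then have CF: "C \<subseteq> F" and lin: "\<And>J K. J \<in> C \<Longrightarrow> K \<in> C \<Longrightarrow> J \<subseteq> K \<or> K \<subseteq> J"
      by (auto simp: subset_chain_def)
    have id: "ideal_set A J" if "J \<in> C" for J using that CF by (auto simp: F_def)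
    have "ideal_set A (\<Union>C)"
    proof
      show "\<Union>C \<subseteq> A" using ideal_set.subset[OF id] by blast
      show "0 \<in> \<Union>C" using ideal_set.zero_mem[OF id] C(1) by blast
      show "x + y \<in> \<Union>C" if "x \<in> \<Union>C" "y \<in> \<Union>C" for x y
      proof -
        obtain J K where "J \<in> C" "K \<in> C" "x \<in> J" "y \<in> K"
          using \<open>x \<in> \<Union>C\<close> \<open>y \<in> \<Union>C\<close> by blast
        then obtain L where "L \<in> C" "x \<in> L" "y \<in> L" using lin by blast
        then show ?thesis using ideal_set.add_mem[OF id] by blast
      qed
      show "a * x \<in> \<Union>C" if "a \<in> A" "x \<in> \<Union>C" for a x
        using that ideal_set.absorb[OF id] by blast
    qed
    then show "\<Union>C \<in> F" using CF C(1) by (fastforce simp: F_def)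
  qed
  then obtain P where PF: "P \<in> F" and max: "\<And>J. J \<in> F \<Longrightarrow> P \<subseteq> J \<Longrightarrow> J = P" by blast
  interpret P: ideal_set A P using PF by (simp add: F_def)
  have meets: "\<exists>p\<in>P. \<exists>a\<in>A. p + a * c \<in> W" if c: "c \<in> A" "c \<notin> P" for c
  proof -
    let ?J = "{x + a * c | x a. x \<in> P \<and> a \<in> A}"
    have "ideal_set A ?J" by (rule ideal_set_add_principal[OF P.ideal_set_axioms c(1)])
    moreover have PJ: "P \<subseteq> ?J" using zero_closed by force
    moreover have "c \<in> ?J" using P.zero_mem one_closed by force
    ultimately have "?J \<inter> W \<noteq> {}" using max[of ?J] c(2) PF by (auto simp: F_def)
    then show ?thesis by auto
  qed
  have "prime_set A P"
  proof
    show "1 \<notin> P" using PF W(2) by (auto simp: F_def)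
    fix x y assume xy: "x \<in> A" "y \<in> A" "x * y \<in> P"
    show "x \<in> P \<or> y \<in> P"
    proof (rule ccontr)
      assume "\<not> (x \<in> P \<or> y \<in> P)"
      then obtain p a q b where *: "p \<in> P" "a \<in> A" "p + a * x \<in> W" "q \<in> P" "b \<in> A" "q + b * y \<in> W"
        using meets xy by meson
      \<comment> \<open>The product of the two elements of \<open>W\<close> is in \<open>P\<close>, because \<open>x * y\<close> is.\<close>
      have "q * (p + a * x) \<in> P" "(b * y) * p \<in> P" "(a * b) * (x * y) \<in> P"
        using * xy by (auto intro: P.absorb P.absorb_right simp: closed P.in_ring)
      then have "q * (p + a * x) + (b * y) * p + (a * b) * (x * y) \<in> P"
        by (intro P.add_mem)
      also have "q * (p + a * x) + (b * y) * p + (a * b) * (x * y) = (p + a * x) * (q + b * y)"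
        by (simp add: algebra_simps)
      finally show False using W(3) * PF by (auto simp: F_def)
    qed
  qed
  then show ?thesis using that meets PF by (auto simp: F_def)
qed

lemma exists_maximal:
  assumes "ideal_set A I" "1 \<notin> I"
  obtains M where "maximal_set A M" "I \<subseteq> M"
proof -
  have *: "{1} \<subseteq> A" "(1::'r) \<in> {1}" "I \<inter> {1} = {}" 
    "\<And>x y :: 'r. x \<in> {1} \<Longrightarrow> y \<in> {1} \<Longrightarrow> x * y \<in> {1}"
    using one_closed assms(2) by auto
  obtain P where P: "prime_set A P" "I \<subseteq> P"
    and meets: "\<forall>c\<in>A - P. \<exists>p\<in>P. \<exists>a\<in>A. p + a * c \<in> {1}"
    by (rule exists_prime_avoiding[OF assms(1) *(1,2,4,3)]) blast
  interpret P: prime_set A P by fact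
  have "maximal_set A P"
  proof
    show "1 \<notin> P" by (rule P.one_notin)
    fix c assume "c \<in> A" "c \<notin> P"
    then obtain p a where "p \<in> P" "a \<in> A" "p + a * c = 1" using meets by blast
    then have "a * c - 1 = - p" by (simp add: algebra_simps)
    then show "\<exists>u\<in>A. u * c - 1 \<in> P" using \<open>p \<in> P\<close> \<open>a \<in> A\<close> P.minus_mem by metis
  qed
  then show ?thesis using that P(2) by blast
qed

end

lemma jacobson_ring_type_iff:
  "jacobson_ring (ring_of_type_algebra :: 'a::comm_ring_1 ring) \<longleftrightarrow>
    (\<forall>P r. prime_set (UNIV :: 'a set) P \<longrightarrow> r \<notin> P \<longrightarrow> (\<exists>M. maximal_set UNIV M \<and> P \<subseteq> M \<and> r \<notin> M))"
    (is "?L \<longleftrightarrow> ?R")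
proof -
  have UNIV: "subring_set (UNIV :: 'a set)" by (rule subring_set_UNIV)
  have carrier: "carrier (ring_of_type_algebra :: 'a ring) = UNIV"
    by (simp add: ring_of_type_algebra_def)
  have L: "?L \<longleftrightarrow> (\<forall>P. prime_set (UNIV :: 'a set) P \<longrightarrow> (\<exists>F\<subseteq>{M. maximal_set UNIV M}. P = \<Inter>F))"
    using subring_set.cring_ring_on[OF UNIV]
    by (simp add: jacobson_ring_def subring_set.primeideal_iff[OF UNIV, unfolded ring_on_UNIV]
        subring_set.maximalideal_iff[OF UNIV, unfolded ring_on_UNIV] ring_on_UNIV carrier)
  have *: "(\<exists>F\<subseteq>{M. maximal_set UNIV M}. P = \<Inter>F) \<longleftrightarrow>
      (\<forall>r. r \<notin> P \<longrightarrow> (\<exists>M. maximal_set UNIV M \<and> P \<subseteq> M \<and> r \<notin> M))" (is "?l \<longleftrightarrow> ?r") for P :: "'a set"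
  proof
    assume ?l
    then obtain F where F: "F \<subseteq> {M. maximal_set UNIV M}" "P = \<Inter>F" by (elim exE conjE)
    show ?r
    proof (intro allI impI)
      fix r assume "r \<notin> P"
      then obtain M where "M \<in> F" "r \<notin> M" using F(2) by (auto simp del: Inter_iff simp: Inter_eq)
      then show "\<exists>M. maximal_set UNIV M \<and> P \<subseteq> M \<and> r \<notin> M" using F by (intro exI[of _ M]) auto
    qed
  next
    assume ?r
    then have "P = \<Inter>{M. maximal_set UNIV M \<and> P \<subseteq> M}" by auto
    then show ?l by (intro exI[of _ "{M. maximal_set UNIV M \<and> P \<subseteq> M}"]) auto
  qed
  show ?thesis unfolding L * by simp
qed

section \<open>Polynomials with coefficients in a set\<close>

definition polys_over :: "'r::comm_ring_1 set \<Rightarrow> 'r poly set" where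
  "polys_over S = {p. \<forall>n. coeff p n \<in> S}"

lemma polys_over_UNIV: "polys_over UNIV = UNIV"
  by (simp add: polys_over_def)

lemma polys_over_mono: "S \<subseteq> T \<Longrightarrow> polys_over S \<subseteq> polys_over T"
  by (auto simp: polys_over_def)

lemma polys_over_coeff: "p \<in> polys_over S \<Longrightarrow> coeff p n \<in> S"
  by (simp add: polys_over_def)

context subring_set
begin

lemma subring_set_polys_over: "subring_set (polys_over A)"
  by unfold_locales (auto simp: polys_over_def coeff_mult intro!: closed)

lemma ideal_set_polys_over:
  assumes "ideal_set A I"
  shows "ideal_set (polys_over A) (polys_over I)"
proof -
  interpret I: ideal_set A I by fact
  interpret P: subring_set "polys_over A" by (rule subring_set_polys_over)
  show ?thesis
    by unfold_locales
      (auto simp: polys_over_def coeff_mult I.zero_mem I.in_ring intro!: I.add_mem I.sum_mem I.absorb)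
qed

lemma monom_in_polys_over: "c \<in> A \<Longrightarrow> monom c n \<in> polys_over A"
  by (auto simp: polys_over_def zero_closed)

lemma const_in_polys_over: "c \<in> A \<Longrightarrow> [:c:] \<in> polys_over A"
  by (auto simp: polys_over_def zero_closed coeff_pCons split: nat.split)

lemma smult_in_polys_over: "c \<in> A \<Longrightarrow> p \<in> polys_over A \<Longrightarrow> Polynomial.smult c p \<in> polys_over A"
  by (auto simp: polys_over_def closed)

lemma poly_in: "p \<in> polys_over A \<Longrightarrow> x \<in> A \<Longrightarrow> poly p x \<in> A"
  by (auto simp: poly_altdef polys_over_def intro!: closed)

end

lemma (in ideal_set) poly_in_ideal: "p \<in> polys_over I \<Longrightarrow> x \<in> A \<Longrightarrow> poly p x \<in> I"
  by (auto simp: poly_altdef polys_over_def intro!: sum_mem absorb_right closed)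

lemma (in ideal_set) polys_over_add: "p \<in> polys_over I \<Longrightarrow> q \<in> polys_over I \<Longrightarrow> p + q \<in> polys_over I"
  by (auto simp: polys_over_def add_mem)

section \<open>Determinants modulo an ideal\<close>

context ideal_set
begin

lemma prod_cong_mod:
  assumes "\<And>i. i \<in> K \<Longrightarrow> f i \<in> A" "\<And>i. i \<in> K \<Longrightarrow> g i \<in> A" "\<And>i. i \<in> K \<Longrightarrow> f i - g i \<in> I"
  shows "prod f K - prod g K \<in> I"
  using assms
proof (induction K rule: infinite_finite_induct)
  case (insert k K)
  have "prod f (insert k K) - prod g (insert k K) =
      f k * (prod f K - prod g K) + (f k - g k) * prod g K"
    using insert.hyps by (simp add: algebra_simps)
  moreover have "f k * (prod f K - prod g K) \<in> I"
    using insert by (intro absorb) auto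
  moreover have "(f k - g k) * prod g K \<in> I"
    using insert by (intro absorb_right prod_closed) auto
  ultimately show ?case by (simp add: add_mem)
qed (auto simp: zero_mem)

text \<open>
  The Leibniz formula is a polynomial in the entries, so it respects congruences. The quotient
  ring, in which the determinants would simply be equal, is thereby avoided.
\<close>

lemma det_cong_mod:
  assumes M: "M \<in> carrier_mat n n" and N: "N \<in> carrier_mat n n"
    and "\<And>i j. i < n \<Longrightarrow> j < n \<Longrightarrow> M $$ (i, j) \<in> A" "\<And>i j. i < n \<Longrightarrow> j < n \<Longrightarrow> N $$ (i, j) \<in> A"
    and "\<And>i j. i < n \<Longrightarrow> j < n \<Longrightarrow> M $$ (i, j) - N $$ (i, j) \<in> I"
  shows "det M - det N \<in> I"
proof -
  have "signof p * (\<Prod>i = 0..<n. M $$ (i, p i)) - signof p * (\<Prod>i = 0..<n. N $$ (i, p i)) \<in> I"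
    if "p permutes {0..<n}" for p
  proof -
    have "(\<Prod>i = 0..<n. M $$ (i, p i)) - (\<Prod>i = 0..<n. N $$ (i, p i)) \<in> I"
      using permutes_in_image[OF that] assms(3-) by (intro prod_cong_mod) auto
    then have "signof p * ((\<Prod>i = 0..<n. M $$ (i, p i)) - (\<Prod>i = 0..<n. N $$ (i, p i))) \<in> I"
      by (intro absorb) (cases p rule: sign_cases; simp add: closed)
    then show ?thesis by (simp add: algebra_simps)
  qed
  then show ?thesis
    unfolding det_def'[OF M] det_def'[OF N] sum_subtractf[symmetric] by (intro sum_mem) auto
qed

end

lemma char_poly_coeff_in_ideal:
  assumes I: "ideal_set UNIV I" and M: "M \<in> carrier_mat n n"
    and entries: "\<And>i j. i < n \<Longrightarrow> j < n \<Longrightarrow> M $$ (i, j) \<in> I" and "k < n"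
  shows "coeff (char_poly M) k \<in> I"
proof -
  interpret I: ideal_set UNIV I by (rule I)
  interpret J: ideal_set UNIV "polys_over I"
    using I.ideal_set_polys_over[OF I] by (simp add: polys_over_UNIV)
  \<comment> \<open>Modulo the entries of \<open>M\<close>, the matrix \<open>X - M\<close> is \<open>X\<close> times the identity.\<close>
  have "det (char_poly_matrix M) - det ([:0, 1:] \<cdot>\<^sub>m 1\<^sub>m n) \<in> polys_over I"
    using M entries
    by (intro J.det_cong_mod[of _ n])
      (auto simp: char_poly_matrix_def polys_over_def coeff_pCons I.zero_mem I.minus_mem split: nat.split)
  moreover have "det ([:0, 1:] \<cdot>\<^sub>m 1\<^sub>m n :: 'a poly mat) = monom 1 n"
    by (simp add: x_as_monom x_pow_n[unfolded One_nat_def])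
  ultimately have "coeff (char_poly M - monom 1 n) k \<in> I"
    by (auto simp: char_poly_def polys_over_def)
  then show ?thesis using \<open>k < n\<close> by simp
qed

section \<open>Integral elements\<close>

interpretation to_closure: inj_idom_hom "to_closure :: 'a::idom \<Rightarrow> 'a fract alg_closure"
  by unfold_locales (simp_all add: to_closure_def)

text \<open>
  The submodule \<open>I W\<close> of the algebraic closure, for a finite set \<open>W\<close> of generators. For \<open>I = UNIV\<close>
  this is the \<open>'a\<close>-module spanned by \<open>W\<close>.
\<close>

definition combos :: "'a::idom set \<Rightarrow> 'a fract alg_closure set \<Rightarrow> 'a fract alg_closure set" where
  "combos I W = {\<Sum>w\<in>W. to_closure (c w) * w | c. \<forall>w\<in>W. c w \<in> I}"

lemma combosE:
  assumes "v \<in> combos I W"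
  obtains c where "v = (\<Sum>w\<in>W. to_closure (c w) * w)" "\<forall>w\<in>W. c w \<in> I"
proof -
  from assms obtain c where "v = (\<Sum>w\<in>W. to_closure (c w) * w)" "\<forall>w\<in>W. c w \<in> I"
    unfolding combos_def by (elim CollectE exE conjE)
  then show ?thesis by (intro that[of c]) simp_all
qed

context
  fixes I :: "'a::idom set"
  assumes I: "ideal_set UNIV I"
begin

interpretation I: ideal_set UNIV I by (rule I)

lemma combos_zero: "0 \<in> combos I W"
  unfolding combos_def by (rule CollectI, rule exI[of _ "\<lambda>_. 0"]) (simp add: I.zero_mem)

lemma combos_add: "v \<in> combos I W \<Longrightarrow> v' \<in> combos I W \<Longrightarrow> v + v' \<in> combos I W"
proof (elim combosE)
  fix c c' assume "v = (\<Sum>w\<in>W. to_closure (c w) * w)" "v' = (\<Sum>w\<in>W. to_closure (c' w) * w)"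
    "\<forall>w\<in>W. c w \<in> I" "\<forall>w\<in>W. c' w \<in> I"
  then show "v + v' \<in> combos I W"
    unfolding combos_def
    by (intro CollectI exI[of _ "\<lambda>w. c w + c' w"])
      (auto simp: I.add_mem to_closure.hom_add sum.distrib algebra_simps)
qed

lemma combos_sum: "(\<And>i. i \<in> K \<Longrightarrow> f i \<in> combos I W) \<Longrightarrow> sum f K \<in> combos I W"
  by (induction K rule: infinite_finite_induct) (auto intro: combos_zero combos_add)

lemma combos_scale: "r \<in> I \<Longrightarrow> v \<in> combos UNIV W \<Longrightarrow> to_closure r * v \<in> combos I W"
proof (elim combosE)
  fix c assume "r \<in> I" "v = (\<Sum>w\<in>W. to_closure (c w) * w)"
  then show "to_closure r * v \<in> combos I W"
    unfolding combos_def
    by (intro CollectI exI[of _ "\<lambda>w. r * c w"])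
      (auto simp: I.absorb_right to_closure.hom_mult sum_distrib_left mult.assoc)
qed

lemma combos_single:
  assumes "finite W" "w \<in> W" "r \<in> I"
  shows "to_closure r * w \<in> combos I W"
proof -
  have "(\<Sum>v\<in>W. to_closure (if v = w then r else 0) * v) = to_closure r * w"
    using assms by (subst sum.remove[of _ w]) auto
  then show ?thesis
    unfolding combos_def
    by (intro CollectI exI[of _ "\<lambda>v. if v = w then r else 0"]) (auto simp: I.zero_mem assms)
qed

lemma combos_scale_ideal: "v \<in> combos I W \<Longrightarrow> to_closure r * v \<in> combos I W"
proof (elim combosE)
  fix c assume "v = (\<Sum>w\<in>W. to_closure (c w) * w)" "\<forall>w\<in>W. c w \<in> I"
  then show "to_closure r * v \<in> combos I W"
    unfolding combos_def
    by (intro CollectI exI[of _ "\<lambda>w. r * c w"])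
      (auto simp: I.absorb to_closure.hom_mult sum_distrib_left mult.assoc)
qed

lemma combos_bind:
  assumes "v \<in> combos UNIV W" "\<And>w. w \<in> W \<Longrightarrow> x * w \<in> combos I V"
  shows "x * v \<in> combos I V"
proof -
  obtain c where c: "v = (\<Sum>w\<in>W. to_closure (c w) * w)" using assms(1) by (rule combosE)
  have "x * v = (\<Sum>w\<in>W. to_closure (c w) * (x * w))"
    by (simp add: c sum_distrib_left algebra_simps)
  also have "\<dots> \<in> combos I V"
    using assms(2) by (intro combos_sum combos_scale_ideal) auto
  finally show ?thesis .
qed

lemma combos_bind_ideal:
  assumes "v \<in> combos I W" "\<And>w. w \<in> W \<Longrightarrow> x * w \<in> combos UNIV V"
  shows "x * v \<in> combos I V"
proof -
  obtain c where c: "v = (\<Sum>w\<in>W. to_closure (c w) * w)" "\<forall>w\<in>W. c w \<in> I"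
    using assms(1) by (rule combosE)
  have "x * v = (\<Sum>w\<in>W. to_closure (c w) * (x * w))"
    by (simp add: c(1) sum_distrib_left algebra_simps)
  also have "\<dots> \<in> combos I V"
    using assms(2) c(2) by (intro combos_sum combos_scale) auto
  finally show ?thesis .
qed

text \<open>
  The determinant trick. If multiplication by \<open>x\<close> maps the module spanned by \<open>W\<close> into \<open>I\<close> times
  that module, it is described on \<open>W\<close> by a matrix with entries in \<open>I\<close>. The vector of generators is
  an eigenvector with eigenvalue \<open>x\<close>, hence \<open>x\<close> is a root of the characteristic polynomial, whose
  lower coefficients are in \<open>I\<close>. For \<open>I = UNIV\<close> this proves integrality; for a proper ideal and
  \<open>x = 1\<close> it is Nakayama's lemma.
\<close>

lemma monic_root_of_multiplier:
  assumes W: "finite W" "1 \<in> W" and x: "\<And>w. w \<in> W \<Longrightarrow> x * w \<in> combos I W"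
  obtains p :: "'a poly" where "lead_coeff p = 1" "upoly_eval p x = 0"
    "\<And>i. i < degree p \<Longrightarrow> coeff p i \<in> I"
proof -
  obtain f where f: "bij_betw f {0..<card W} W" using ex_bij_betw_nat_finite[OF W(1)] by blast
  define n where "n = card W"
  have fW: "f i \<in> W" if "i < n" for i
    using f that by (auto simp: n_def bij_betw_def)
  have "\<forall>w\<in>W. \<exists>c. x * w = (\<Sum>v\<in>W. to_closure (c v) * v) \<and> (\<forall>v\<in>W. c v \<in> I)"
    using x by (auto simp: combos_def)
  from bchoice[OF this] obtain c where
    "\<forall>w\<in>W. x * w = (\<Sum>v\<in>W. to_closure (c w v) * v) \<and> (\<forall>v\<in>W. c w v \<in> I)"
    by (elim exE)
  then have c: "\<And>w. w \<in> W \<Longrightarrow> x * w = (\<Sum>v\<in>W. to_closure (c w v) * v)"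
    "\<And>w v. w \<in> W \<Longrightarrow> v \<in> W \<Longrightarrow> c w v \<in> I" by simp_all
  define M where "M = mat n n (\<lambda>(i, j). c (f i) (f j))"
  define v where "v = vec n f"
  have M: "M \<in> carrier_mat n n" by (simp add: M_def)
  have M': "map_mat to_closure M \<in> carrier_mat n n" by (simp add: M_def)
  have "map_mat to_closure M *\<^sub>v v = x \<cdot>\<^sub>v v"
  proof (rule eq_vecI)
    fix i assume "i < dim_vec (x \<cdot>\<^sub>v v)"
    then have i: "i < n" by (simp add: v_def)
    have "(map_mat to_closure M *\<^sub>v v) $ i = (\<Sum>j = 0..<n. to_closure (c (f i) (f j)) * f j)"
      using i by (simp add: M_def v_def scalar_prod_def)
    also have "\<dots> = (\<Sum>v\<in>W. to_closure (c (f i) v) * v)"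
      using sum.reindex_bij_betw[OF f, of "\<lambda>v. to_closure (c (f i) v) * v"] by (simp add: n_def)
    finally show "(map_mat to_closure M *\<^sub>v v) $ i = (x \<cdot>\<^sub>v v) $ i"
      using i c(1)[OF fW[OF i]] by (simp add: v_def)
  qed (simp add: M_def v_def)
  \<comment> \<open>An eigenvector has to be nonzero, which is why \<open>1\<close> is among the generators.\<close>
  moreover have "v \<noteq> 0\<^sub>v n"
  proof -
    obtain i where "i < n" "f i = 1" using f W(2) unfolding bij_betw_def n_def by (metis atLeastLessThan_iff imageE)
    then have "v $ i \<noteq> 0\<^sub>v n $ i" by (simp add: v_def)
    then show ?thesis by metis
  qed
  ultimately have "eigenvalue (map_mat to_closure M) x"
    unfolding eigenvalue_def eigenvector_def by (intro exI[of _ v]) (auto simp: M_def v_def)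
  then have "poly (char_poly (map_mat to_closure M)) x = 0"
    using eigenvalue_root_char_poly[OF M'] by simp
  then have "upoly_eval (char_poly M) x = 0"
    by (simp add: to_closure.char_poly_hom[OF M] upoly_eval_def)
  moreover have deg: "degree (char_poly M) = n" "lead_coeff (char_poly M) = 1"
    using degree_monic_char_poly[OF M] by auto
  moreover have "coeff (char_poly M) k \<in> I" if "k < n" for k
    using c(2) fW that by (intro char_poly_coeff_in_ideal[OF I M]) (auto simp: M_def)
  ultimately show ?thesis using that by metis
qed

end

lemma ideal_set_UNIV: "ideal_set UNIV (UNIV :: 'r::comm_ring_1 set)"
  by unfold_locales auto

text \<open>
  Multiplication by \<open>x\<close> maps the module spanned by \<open>W\<close> to itself. An element is integral when this
  holds for some finite \<open>W\<close> that contains \<open>1\<close> (\<open>integral_closure_iff\<close>), and this description makes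
  the closure properties of integral elements evident.
\<close>

definition stable :: "'a::idom fract alg_closure set \<Rightarrow> 'a fract alg_closure \<Rightarrow> bool" where
  "stable W x \<longleftrightarrow> (\<forall>w\<in>W. x * w \<in> combos UNIV W)"

lemma stable_combos: "stable W x \<Longrightarrow> v \<in> combos UNIV W \<Longrightarrow> x * v \<in> combos UNIV W"
  by (rule combos_bind[OF ideal_set_UNIV]) (auto simp: stable_def)

lemma combos_self: "finite W \<Longrightarrow> w \<in> W \<Longrightarrow> w \<in> combos UNIV W"
  using combos_single[OF ideal_set_UNIV, of W w 1] by simp

lemma stable_diff: "stable W x \<Longrightarrow> stable W y \<Longrightarrow> stable W (x - y)"
proof -
  assume *: "stable W x" "stable W y"
  show ?thesis unfolding stable_def
  proof
    fix w assume "w \<in> W"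
    then have "x * w + to_closure (- 1) * (y * w) \<in> combos UNIV W"
      using * by (intro combos_add combos_scale_ideal ideal_set_UNIV) (auto simp: stable_def)
    then show "(x - y) * w \<in> combos UNIV W"
      by (simp add: to_closure.hom_uminus algebra_simps)
  qed
qed

lemma stable_mult: "stable W x \<Longrightarrow> stable W y \<Longrightarrow> stable W (x * y)"
  using stable_combos[of W x] by (auto simp: stable_def mult.assoc)

lemma stable_to_closure: "finite W \<Longrightarrow> stable W (to_closure r)"
  by (auto simp: stable_def intro: combos_single[OF ideal_set_UNIV])

text \<open>
  Generators of the product of two modules, on which everything acts that acts on one of the
  factors.
\<close>

definition products :: "'r::comm_ring_1 set \<Rightarrow> 'r set \<Rightarrow> 'r set" where
  "products W V = (\<lambda>(w, v). w * v) ` (W \<times> V)"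

lemma finite_products: "finite W \<Longrightarrow> finite V \<Longrightarrow> finite (products W V)"
  by (simp add: products_def)

lemma mult_in_products: "w \<in> W \<Longrightarrow> v \<in> V \<Longrightarrow> w * v \<in> products W V"
  by (auto simp: products_def)

lemma one_in_products: "1 \<in> W \<Longrightarrow> 1 \<in> V \<Longrightarrow> 1 \<in> products W V"
  using mult_in_products[of 1 W 1 V] by simp

lemma products_commute: "products W V = products V W"
proof -
  have "products W V \<subseteq> products V W" for W V :: "'a set"
  proof
    fix u assume "u \<in> products W V"
    then obtain w v where "u = w * v" "w \<in> W" "v \<in> V" by (auto simp: products_def)
    then show "u \<in> products V W" by (simp add: mult_in_products mult.commute[of w])
  qed
  then show ?thesis by blast
qed

lemmas products_basics = finite_products one_in_products mult_in_products products_commute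

lemma multiplier_products:
  assumes "finite W" "finite V" "ideal_set UNIV I" "\<And>w. w \<in> W \<Longrightarrow> x * w \<in> combos I W"
    and u: "u \<in> products W V"
  shows "x * u \<in> combos I (products W V)"
proof -
  obtain w v where wv: "u = w * v" "w \<in> W" "v \<in> V" using u by (auto simp: products_def)
  have "v * (x * w) \<in> combos I (products W V)"
  proof (rule combos_bind_ideal[OF assms(3) assms(4)[OF wv(2)]])
    fix w' assume "w' \<in> W"
    then have "w' * v \<in> products W V" using wv(3) by (rule mult_in_products)
    then show "v * w' \<in> combos UNIV (products W V)"
      using assms(1,2) by (simp add: mult.commute combos_self finite_products)
  qed
  then show ?thesis by (simp add: wv algebra_simps)
qed

lemma stable_products:
  assumes "finite W" "finite V"
  shows "stable W x \<Longrightarrow> stable (products W V) x" "stable V x \<Longrightarrow> stable (products W V) x"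
  using multiplier_products[OF assms ideal_set_UNIV, of x]
    multiplier_products[OF assms(2,1) ideal_set_UNIV, of x]
  by (auto simp: stable_def products_basics(4)[of W V])

text \<open>
  The module over \<open>W\<close> is enlarged by the powers of \<open>z\<close> below the degree of \<open>P\<close>, and the equation
  \<open>P(z) = 0\<close> reduces the next power to these. As the coefficients of \<open>P\<close> only have to act on the
  module, the lemma serves for equations over \<open>'a\<close> and over the integral closure alike.
\<close>

lemma adjoin_root:
  fixes P :: "'a::idom fract alg_closure poly"
  assumes W: "finite W" "1 \<in> W" and P: "lead_coeff P = 1" "\<And>i. stable W (coeff P i)" "poly P z = 0"
  obtains V where "finite V" "1 \<in> V" "stable V z"
proof -
  define d where "d = degree P"
  define V where "V = (\<lambda>(w, j). w * z ^ j) ` (W \<times> {..<d})"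
  \<comment> \<open>A monic polynomial of degree zero has no root; hence \<open>1\<close> is among the new generators.\<close>
  have "d \<noteq> 0"
  proof
    assume "d = 0"
    then have "P = 1" using P(1) by (metis d_def degree_0_id one_pCons)
    then show False using P(3) by simp
  qed
  have fin: "finite V" using W by (simp add: V_def)
  have "1 \<in> V" using \<open>d \<noteq> 0\<close> W(2) by (auto simp: V_def intro!: image_eqI[of _ _ "(1, 0)"])
  have lift: "z ^ i * v \<in> combos UNIV V" if "v \<in> combos UNIV W" "i < d" for v i
  proof (rule combos_bind[OF ideal_set_UNIV that(1)])
    fix w assume "w \<in> W"
    then have "w * z ^ i \<in> V" using that(2) by (auto simp: V_def)
    then show "z ^ i * w \<in> combos UNIV V" using combos_self[OF fin] by (simp add: mult.commute)
  qed
  have "z * u \<in> combos UNIV V" if u: "u \<in> V" for u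
  proof -
    obtain w j where wj: "u = w * z ^ j" "w \<in> W" "j < d" using u by (auto simp: V_def)
    show ?thesis
    proof (cases "Suc j < d")
      case True
      then have "z * u = w * z ^ Suc j" by (simp add: wj)
      moreover have "w * z ^ Suc j \<in> V"
        using wj True by (auto simp: V_def simp del: power_Suc intro!: image_eqI[of _ _ "(w, Suc j)"])
      ultimately have "z * u \<in> V" by (simp only:)
      then show ?thesis using combos_self[OF fin] by simp
    next
      case False
      then have "d = Suc j" using wj(3) by simp
      have "0 = (\<Sum>i<Suc d. coeff P i * z ^ i)"
        using P(3) by (simp add: poly_altdef d_def lessThan_Suc_atMost)
      then have zd: "z ^ d = - (\<Sum>i<d. coeff P i * z ^ i)"
        using P(1) by (simp add: d_def[symmetric] eq_neg_iff_add_eq_0 add.commute)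
      have "z * u = w * z ^ d" using wj(1) \<open>d = Suc j\<close> by (simp add: mult_ac)
      also have "\<dots> = to_closure (- 1) * (w * (\<Sum>i<d. coeff P i * z ^ i))"
        unfolding zd by (simp add: to_closure.hom_uminus)
      also have "w * (\<Sum>i<d. coeff P i * z ^ i) = (\<Sum>i<d. z ^ i * (coeff P i * w))"
        by (simp add: sum_distrib_left mult_ac)
      also have "to_closure (- 1) * (\<Sum>i<d. z ^ i * (coeff P i * w)) \<in> combos UNIV V"
        using P(2) wj(2)
        by (intro combos_scale_ideal combos_sum ideal_set_UNIV lift) (auto simp: stable_def)
      finally show ?thesis .
    qed
  qed
  then show ?thesis using that fin \<open>1 \<in> V\<close> by (auto simp: stable_def)
qed

lemma integral_closure_iff:
  "x \<in> integral_closure \<longleftrightarrow> (\<exists>W. finite W \<and> 1 \<in> W \<and> stable W x)"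
proof
  assume "x \<in> integral_closure"
  then obtain p :: "'a poly" where p: "lead_coeff p = 1" "upoly_eval p x = 0"
    by (auto simp: integral_closure_def)
  show "\<exists>W. finite W \<and> 1 \<in> W \<and> stable W x"
  proof (rule adjoin_root[of "{1}" "map_poly to_closure p" x])
    show "poly (map_poly to_closure p) x = 0" using p(2) by (simp add: upoly_eval_def)
  qed (auto simp: p(1) stable_to_closure)
next
  assume "\<exists>W. finite W \<and> 1 \<in> W \<and> stable W x"
  then obtain W where W: "finite W" "1 \<in> W" "stable W x" by blast
  then show "x \<in> integral_closure"
    using monic_root_of_multiplier[OF ideal_set_UNIV W(1,2), of x]
    by (auto simp: stable_def integral_closure_def)
qed

lemma finite_integral_stable:
  assumes "finite Y" "Y \<subseteq> integral_closure"
  shows "\<exists>W. finite W \<and> 1 \<in> W \<and> (\<forall>y\<in>Y. stable W y)"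
  using assms
proof (induction Y rule: finite_induct)
  case empty
  show ?case by (rule exI[of _ "{1}"]) auto
next
  case (insert y Y)
  then obtain W V where "finite W" "1 \<in> W" "\<forall>y\<in>Y. stable W y" "finite V" "1 \<in> V" "stable V y"
    using integral_closure_iff[of y] by auto
  then show ?case by (intro exI[of _ "products W V"]) (auto simp: products_basics stable_products)
qed

interpretation integral_closure: subring_set integral_closure
proof
  show "1 \<in> integral_closure"
    using stable_to_closure[of "{1}" 1] by (auto simp: integral_closure_iff intro!: exI[of _ "{1}"])
  fix x y :: "'a fract alg_closure" assume "x \<in> integral_closure" "y \<in> integral_closure"
  then obtain W where "finite W" "1 \<in> W" "stable W x" "stable W y"
    using finite_integral_stable[of "{x, y}"] by auto
  then show "x - y \<in> integral_closure" "x * y \<in> integral_closure"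
    by (auto simp: integral_closure_iff intro: stable_diff stable_mult)
qed

lemma to_closure_integral: "to_closure r \<in> integral_closure"
  using stable_to_closure[of "{1}" r] by (auto simp: integral_closure_iff intro!: exI[of _ "{1}"])

lemma integrally_closed:
  assumes "lead_coeff P = 1" "P \<in> polys_over integral_closure" "poly P z = 0"
  shows "z \<in> integral_closure"
proof -
  have "coeff P ` {..degree P} \<subseteq> integral_closure"
    using assms(2) by (auto simp: polys_over_def)
  then obtain W where W: "finite W" "1 \<in> W" "\<forall>i\<le>degree P. stable W (coeff P i)"
    using finite_integral_stable[of "coeff P ` {..degree P}"] by auto
  have "stable W (coeff P i)" for i
    using W(3) stable_to_closure[OF W(1), of 0] by (cases "i \<le> degree P") (auto simp: coeff_eq_0)
  then obtain V where "finite V" "1 \<in> V" "stable V z"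
    using adjoin_root[OF W(1,2) assms(1) _ assms(3)] by metis
  then show ?thesis by (auto simp: integral_closure_iff)
qed

text \<open>
  This makes the residue field of the integral closure at a maximal ideal algebraically closed.
\<close>

lemma monic_has_integral_root:
  assumes "lead_coeff P = 1" "P \<in> polys_over integral_closure" "degree P > 0"
  obtains z where "z \<in> integral_closure" "poly P z = 0"
  using alg_closed_imp_poly_has_root[OF assms(3)] integrally_closed[OF assms(1,2)] that by blast

section \<open>Maximal ideals of the integral closure\<close>

text \<open>
  Lying over, in the form that a proper ideal \<open>I\<close> generates a proper ideal of the integral closure.
  If \<open>1\<close> were in the extended ideal, it would map some finitely generated module into \<open>I\<close> times
  itself, and the determinant trick would put \<open>1\<close> into \<open>I\<close>.
\<close>

lemma proper_ideal_extends:
  assumes I: "ideal_set UNIV I" and "1 \<notin> I"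
  obtains J where "ideal_set integral_closure J" "to_closure ` I \<subseteq> J" "1 \<notin> J"
proof -
  interpret I: ideal_set UNIV I by (rule I)
  \<comment> \<open>An ideal that contains \<open>I\<close>, and whose elements come with a module as in the determinant trick.\<close>
  define J where "J = {x \<in> integral_closure. \<exists>W. finite W \<and> 1 \<in> W \<and> (\<forall>w\<in>W. x * w \<in> combos I W)}"
  have "ideal_set integral_closure J"
  proof
    show "J \<subseteq> integral_closure" by (auto simp: J_def)
    show "0 \<in> J"
      by (auto simp: J_def integral_closure.zero_closed intro!: exI[of _ "{1}"] combos_zero I)
    show "x + y \<in> J" if "x \<in> J" "y \<in> J" for x y
    proof -
      obtain W V where *: "finite W" "1 \<in> W" "\<And>w. w \<in> W \<Longrightarrow> x * w \<in> combos I W"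
        "finite V" "1 \<in> V" "\<And>v. v \<in> V \<Longrightarrow> y * v \<in> combos I V"
        using \<open>x \<in> J\<close> \<open>y \<in> J\<close> by (auto simp: J_def)
      have "x * u \<in> combos I (products W V)" "y * u \<in> combos I (products W V)"
        if "u \<in> products W V" for u
        using multiplier_products[OF *(1,4) I *(3) that] multiplier_products[OF *(4,1) I *(6), of u] that
        by (auto simp: products_basics(4)[of V])
      then have "(x + y) * u \<in> combos I (products W V)" if "u \<in> products W V" for u
        using that by (simp add: distrib_right combos_add I)
      then show ?thesis
        using * \<open>x \<in> J\<close> \<open>y \<in> J\<close> unfolding J_def
        by (auto intro!: integral_closure.add_closed exI[of _ "products W V"] products_basics)
    qed
    show "a * x \<in> J" if "a \<in> integral_closure" "x \<in> J" for a x
    proof -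
      obtain W V where *: "finite W" "1 \<in> W" "\<And>w. w \<in> W \<Longrightarrow> x * w \<in> combos I W"
        "finite V" "1 \<in> V" "stable V a"
        using \<open>a \<in> integral_closure\<close> \<open>x \<in> J\<close> by (auto simp: J_def integral_closure_iff)
      have "x * u \<in> combos I (products W V)" if "u \<in> products W V" for u
        using multiplier_products[OF *(1,4) I *(3) that] .
      moreover have "stable (products W V) a" using stable_products[OF *(1,4)] *(6) by blast
      ultimately have "a * (x * u) \<in> combos I (products W V)" if "u \<in> products W V" for u
        using that combos_bind_ideal[OF I, of "x * u" "products W V"] by (auto simp: stable_def)
      then show ?thesis
        using * that unfolding J_def
        by (auto intro!: integral_closure.mult_closed exI[of _ "products W V"] products_basics simp: mult.assoc)
    qed
  qed
  moreover have "to_closure ` I \<subseteq> J"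
    using combos_single[of I "{1}" 1]
    by (auto simp: J_def to_closure_integral I intro!: exI[of _ "{1}"])
  moreover have "1 \<notin> J"
  proof
    assume "1 \<in> J"
    then obtain W where W: "finite W" "1 \<in> W" "\<And>w. w \<in> W \<Longrightarrow> 1 * w \<in> combos I W"
      by (auto simp: J_def)
    obtain p :: "'a poly" where p: "lead_coeff p = 1" "upoly_eval p 1 = 0"
      "\<And>i. i < degree p \<Longrightarrow> coeff p i \<in> I"
      using monic_root_of_multiplier[OF I W] by blast
    have "poly p 1 = 0"
      using p(2) to_closure.poly_map_poly[of p 1] by (simp add: upoly_eval_def)
    then have "(\<Sum>i<degree p. coeff p i) + 1 = 0"
      using p(1) by (simp add: poly_altdef lessThan_Suc_atMost[symmetric])
    then have "1 = - (\<Sum>i<degree p. coeff p i)" by (simp add: eq_neg_iff_add_eq_0 add.commute)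
    also have "\<dots> \<in> I" using p(3) by (intro I.minus_mem I.sum_mem) auto
    finally show False using \<open>1 \<notin> I\<close> by blast
  qed
  ultimately show ?thesis using that by blast
qed

lemma maximal_lying_over:
  assumes "maximal_set UNIV (m :: 'a::idom set)"
  obtains M where "maximal_set integral_closure M" "\<And>r. to_closure r \<in> M \<longleftrightarrow> r \<in> m"
proof -
  interpret m: maximal_set UNIV m by fact
  obtain J where J: "ideal_set integral_closure J" "to_closure ` m \<subseteq> J" "1 \<notin> J"
    using proper_ideal_extends[OF m.ideal_set_axioms m.proper] .
  obtain M where M: "maximal_set integral_closure M" "J \<subseteq> M"
    using integral_closure.exists_maximal[OF J(1,3)] .
  interpret M: maximal_set integral_closure M by fact
  have "r \<in> m" if r: "to_closure r \<in> M" for r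
  proof (rule ccontr)
    assume "r \<notin> m"
    then obtain u where "u * r - 1 \<in> m" using m.inverse_mod by auto
    then have "to_closure u * to_closure r - 1 \<in> M"
      using J(2) M(2) by (metis image_subset_iff subsetD to_closure.hom_minus to_closure.hom_mult to_closure.hom_one)
    moreover have "to_closure u * to_closure r \<in> M" using r by (intro M.absorb to_closure_integral)
    ultimately show False using M.mem_cong M.proper by blast
  qed
  then show ?thesis using that M J(2) by blast
qed

text \<open>
  For \<open>x\<close> outside the contraction let \<open>y\<close> be an inverse of \<open>x\<close> modulo \<open>M\<close>. Multiplying an integral
  equation of degree \<open>d\<close> for \<open>y\<close> by \<open>x ^ d\<close> and replacing \<open>y * x\<close> by \<open>1\<close> turns it into a relation
  over \<open>'a\<close> that exhibits an inverse of \<open>x\<close>.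
\<close>

lemma maximal_contraction:
  assumes "maximal_set integral_closure M"
  shows "maximal_set UNIV {r :: 'a::idom. to_closure r \<in> M}" (is "maximal_set UNIV ?m")
proof -
  interpret M: maximal_set integral_closure M by fact
  show ?thesis
  proof
    fix x :: 'a assume "x \<notin> ?m"
    then obtain y where y: "y \<in> integral_closure" "y * to_closure x - 1 \<in> M"
      using M.inverse_mod[OF to_closure_integral] by auto
    obtain p :: "'a poly" where p: "lead_coeff p = 1" "upoly_eval p y = 0"
      using y(1) by (auto simp: integral_closure_def)
    let ?d = "degree p" and ?x = "to_closure x"
    define u where "u = - (\<Sum>i<?d. coeff p i * x ^ (?d - Suc i))"
    \<comment> \<open>The error made when the powers of \<open>y * x\<close> are replaced by \<open>1\<close>.\<close>
    have "(\<Sum>i\<le>?d. to_closure (coeff p i * x ^ (?d - i)) * ((y * ?x) ^ i - 1)) \<in> M"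
    proof (intro M.sum_mem M.absorb to_closure_integral)
      fix i
      have "(y * ?x) ^ i - 1 = (\<Sum>j<i. (y * ?x) ^ j) * (y * ?x - 1)"
        by (simp add: power_diff_1_eq mult.commute)
      also have "\<dots> \<in> M"
        using y by (intro M.absorb integral_closure.closed to_closure_integral)
      finally show "(y * ?x) ^ i - 1 \<in> M" .
    qed
    moreover have "(\<Sum>i\<le>?d. to_closure (coeff p i * x ^ (?d - i)) * (y * ?x) ^ i) = ?x ^ ?d * upoly_eval p y"
      by (auto simp: upoly_eval_def poly_altdef sum_distrib_left power_mult_distrib
          to_closure.hom_mult to_closure.hom_power power_add[symmetric] intro!: sum.cong)
    ultimately have "- to_closure (\<Sum>i\<le>?d. coeff p i * x ^ (?d - i)) \<in> M"
      using p(2) by (simp add: right_diff_distrib sum_subtractf to_closure.hom_sum)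
    moreover have "(\<Sum>i\<le>?d. coeff p i * x ^ (?d - i)) = 1 - u * x"
    proof -
      have "(\<Sum>i<?d. coeff p i * x ^ (?d - i)) = (\<Sum>i<?d. coeff p i * x ^ (?d - Suc i)) * x"
        unfolding sum_distrib_right
        by (intro sum.cong) (auto simp: mult.assoc power_Suc2[symmetric] Suc_diff_Suc simp del: power_Suc)
      then show ?thesis using p(1) by (simp add: u_def lessThan_Suc_atMost[symmetric])
    qed
    ultimately have "to_closure (- (1 - u * x)) \<in> M" by (simp only: to_closure.hom_uminus)
    then have "u * x - 1 \<in> ?m" by simp
    then show "\<exists>u\<in>UNIV. u * x - 1 \<in> ?m" by blast
  qed (auto simp: to_closure.hom_add to_closure.hom_mult M.zero_mem M.proper
      intro: M.add_mem M.absorb to_closure_integral)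
qed

section \<open>Extending homomorphisms by one variable\<close>

text \<open>
  Leading terms with coefficient in \<open>I\<close> are dropped, so that the degree becomes the degree of the
  residue class modulo \<open>I\<close>.
\<close>

lemma (in ideal_set) trim_mod:
  assumes "p \<in> polys_over A"
  shows "\<exists>q\<in>polys_over A. p - q \<in> polys_over I \<and> degree q \<le> degree p \<and> (q = 0 \<or> lead_coeff q \<notin> I)"
  using assms
proof (induction "degree p" arbitrary: p rule: less_induct)
  case less
  show ?case
  proof (cases "lead_coeff p \<in> I")
    case False
    then show ?thesis
      using less.prems by (intro bexI[of _ p]) (auto simp: polys_over_def zero_mem)
  next
    case lead: True
    show ?thesis
    proof (cases "degree p = 0")
      case True
      then have "coeff p n \<in> I" for n
        using lead zero_mem by (cases "n = 0") (auto simp: coeff_eq_0)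
      then show ?thesis
        using zero_closed by (intro bexI[of _ 0]) (auto simp: polys_over_def)
    next
      case False
      let ?p = "p - monom (lead_coeff p) (degree p)"
      have "?p \<in> polys_over A"
        using less.prems zero_closed by (auto simp: polys_over_def intro!: diff_closed)
      moreover have "degree ?p < degree p"
        using False by (intro degree_lessI) (auto simp: coeff_eq_0)
      ultimately obtain q where q: "q \<in> polys_over A" "?p - q \<in> polys_over I"
        "degree q \<le> degree ?p" "q = 0 \<or> lead_coeff q \<notin> I"
        using less.hyps by blast
      have "p - q \<in> polys_over I"
      proof -
        have "monom (lead_coeff p) (degree p) \<in> polys_over I"
          using lead zero_mem by (auto simp: polys_over_def)
        from polys_over_add[OF this q(2)] show ?thesis by (simp add: algebra_simps)
      qed
      then show ?thesis using q \<open>degree ?p < degree p\<close> by (intro bexI[of _ q]) auto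
    qed
  qed
qed

lemma (in subring_set) pseudo_division:
  assumes p: "p \<in> polys_over A" "degree p > 0" and h: "h \<in> polys_over A"
  shows "\<exists>k. \<exists>t\<in>polys_over A. degree (Polynomial.smult (lead_coeff p ^ k) h - t * p) < degree p"
  using h
proof (induction "degree h" arbitrary: h rule: less_induct)
  case less
  interpret P: subring_set "polys_over A" by (rule subring_set_polys_over)
  let ?c = "lead_coeff p"
  show ?case
  proof (cases "degree h < degree p")
    case True
    then show ?thesis using P.zero_closed by (intro exI[of _ 0] bexI[of _ 0]) auto
  next
    case False
    let ?m = "monom (lead_coeff h) (degree h - degree p)"
    let ?h = "Polynomial.smult ?c h - ?m * p"
    have m: "?m \<in> polys_over A"
      using less.prems by (intro monom_in_polys_over) (auto simp: polys_over_def)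
    have "?h \<in> polys_over A"
      using p less.prems m by (intro P.diff_closed P.mult_closed smult_in_polys_over) (auto simp: polys_over_def)
    moreover have "degree ?h < degree h"
    proof (rule degree_lessI)
      show "?h \<noteq> 0 \<or> degree h > 0" using False p(2) by auto
      show "\<forall>n\<ge>degree h. coeff ?h n = 0"
      proof (intro allI impI)
        fix n assume "n \<ge> degree h"
        then show "coeff ?h n = 0"
          using False by (cases "n = degree h") (auto simp: coeff_monom_mult coeff_eq_0)
      qed
    qed
    ultimately obtain k t where kt: "t \<in> polys_over A"
      "degree (Polynomial.smult (?c ^ k) ?h - t * p) < degree p"
      using less.hyps by blast
    have "Polynomial.smult (?c ^ k) ?h - t * p =
        Polynomial.smult (?c ^ Suc k) h - (Polynomial.smult (?c ^ k) ?m + t) * p"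
      by (simp add: algebra_simps smult_diff_right)
    moreover have "Polynomial.smult (?c ^ k) ?m + t \<in> polys_over A"
      using p m kt by (intro P.add_closed smult_in_polys_over power_closed) (auto simp: polys_over_def)
    ultimately show ?thesis using kt(2) by metis
  qed
qed

lemma polys_over_contraction_subset:
  assumes "subring_set A" "ideal_set (polys_over A) J" "\<And>s. s \<in> q \<Longrightarrow> [:s:] \<in> J"
  shows "polys_over q \<subseteq> J"
proof
  interpret A: subring_set A by fact
  interpret J: ideal_set "polys_over A" J by fact
  fix p assume p: "p \<in> polys_over q"
  have "p = (\<Sum>i\<le>degree p. monom 1 i * [:coeff p i:])"
    by (subst poly_as_sum_of_monoms[symmetric]) (simp add: monom_altdef smult_one mult.commute)
  also have "\<dots> \<in> J"
    using p assms(3)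
    by (intro J.sum_mem J.absorb A.monom_in_polys_over A.one_closed) (auto simp: polys_over_def)
  finally show "p \<in> J" .
qed

lemma ideal_set_contraction:
  assumes "subring_set A" "ideal_set (polys_over A) J"
  shows "ideal_set A {s \<in> A. [:s:] \<in> J}" (is "ideal_set A ?q")
proof -
  interpret A: subring_set A by fact
  interpret J: ideal_set "polys_over A" J by fact
  show ?thesis
  proof
    show "x + y \<in> ?q" if "x \<in> ?q" "y \<in> ?q" for x y
      using that J.add_mem[of "[:x:]" "[:y:]"] by (simp add: A.add_closed)
    show "a * x \<in> ?q" if "a \<in> A" "x \<in> ?q" for a x
      using that J.absorb[of "[:a:]" "[:x:]"]
      by (simp add: A.mult_closed A.const_in_polys_over mult.commute)
  qed (auto simp: A.zero_closed J.zero_mem)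
qed

lemma prime_set_contraction:
  assumes "subring_set A" "prime_set (polys_over A) Q"
  shows "prime_set A {s \<in> A. [:s:] \<in> Q}" (is "prime_set A ?q")
proof -
  interpret A: subring_set A by fact
  interpret Q: prime_set "polys_over A" Q by fact
  interpret q: ideal_set A ?q by (rule ideal_set_contraction[OF assms(1) Q.ideal_set_axioms])
  show ?thesis
  proof
    show "1 \<notin> ?q" using Q.one_notin by (simp add: one_pCons)
    show "x \<in> ?q \<or> y \<in> ?q" if "x \<in> A" "y \<in> A" "x * y \<in> ?q" for x y
      using that Q.prime[of "[:x:]" "[:y:]"] by (auto simp: A.const_in_polys_over mult.commute)
  qed
qed

text \<open>
  The element \<open>p\<close> has the least degree among the elements of \<open>J\<close> that are not over \<open>q\<close>. The
  remainders of pseudo-division by \<open>p\<close> are in \<open>J\<close> and of smaller degree, hence over \<open>q\<close>. When \<open>q\<close> is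
  prime, this says that \<open>p\<close> generates the ideal \<open>J\<close> over the fraction field of \<open>A/q\<close>. The degree of
  \<open>p\<close> is positive since a constant in \<open>J\<close> is in \<open>q\<close>.
\<close>

lemma pseudo_generator:
  assumes A: "subring_set A" and q: "ideal_set A q" and J: "ideal_set (polys_over A) J"
    and contr: "\<And>s. s \<in> A \<Longrightarrow> [:s:] \<in> J \<longleftrightarrow> s \<in> q" and not: "\<not> J \<subseteq> polys_over q"
  obtains p where "p \<in> J" "degree p > 0" "lead_coeff p \<notin> q"
    "\<forall>h\<in>J. degree h < degree p \<longrightarrow> h \<in> polys_over q"
    "\<forall>h\<in>J. \<exists>k. \<exists>t\<in>polys_over A. Polynomial.smult (lead_coeff p ^ k) h - t * p \<in> polys_over q"
proof -
  interpret A: subring_set A by fact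
  interpret q: ideal_set A q by fact
  interpret J: ideal_set "polys_over A" J by fact
  have qJ: "polys_over q \<subseteq> J"
    by (rule polys_over_contraction_subset[OF A J]) (simp add: contr q.in_ring)
  obtain p0 where p0: "p0 \<in> J" "p0 \<notin> polys_over q"
    and min: "\<And>h. h \<in> J \<Longrightarrow> h \<notin> polys_over q \<Longrightarrow> degree p0 \<le> degree h"
    using not ex_has_least_nat[of "\<lambda>h. h \<in> J \<and> h \<notin> polys_over q" _ degree] by (metis subsetI)
  obtain p where p: "p \<in> polys_over A" "p0 - p \<in> polys_over q" "degree p \<le> degree p0"
    "p = 0 \<or> lead_coeff p \<notin> q"
    using q.trim_mod J.in_ring p0(1) by blast
  have pJ: "p \<in> J" using p(2) p0(1) qJ J.mem_cong by blast
  have "p \<noteq> 0" using p(2) p0(2) by auto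
  then have lead: "lead_coeff p \<notin> q" using p(4) by blast
  have "degree p > 0"
  proof (rule ccontr)
    assume "\<not> degree p > 0"
    then have "degree p = 0" by simp
    then obtain c where c: "p = [:c:]" by (rule degree_eq_zeroE)
    then have "c \<in> A" using polys_over_coeff[OF p(1), of 0] by simp
    then show False using contr pJ lead c by (auto split: if_splits)
  qed
  moreover have small: "\<forall>h\<in>J. degree h < degree p \<longrightarrow> h \<in> polys_over q"
    using min p(3) by fastforce
  moreover have "\<exists>k. \<exists>t\<in>polys_over A. Polynomial.smult (lead_coeff p ^ k) h - t * p \<in> polys_over q"
    if h: "h \<in> J" for h
  proof -
    obtain k t where kt: "t \<in> polys_over A"
      "degree (Polynomial.smult (lead_coeff p ^ k) h - t * p) < degree p"
      using A.pseudo_division[OF p(1) \<open>degree p > 0\<close>] J.in_ring h by blast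
    have "[:lead_coeff p ^ k:] * h - t * p \<in> J"
      using p(1) kt(1) h pJ
      by (intro J.diff_mem J.absorb A.const_in_polys_over A.power_closed) (auto simp: polys_over_def)
    then show ?thesis using small kt by auto
  qed
  ultimately show ?thesis using that pJ lead by blast
qed

text \<open>
  The residue field of \<open>A\<close> at \<open>I\<close> is algebraically closed, since monic polynomials even have roots in
  \<open>A\<close> itself.
\<close>

locale alg_closed_residue = maximal_set +
  assumes monic_root: "lead_coeff P = 1 \<Longrightarrow> P \<in> polys_over A \<Longrightarrow> degree P > 0 \<Longrightarrow> \<exists>z\<in>A. poly P z = 0"
begin

lemma solve_mod:
  assumes P: "P \<in> polys_over A" "degree P > 0" "lead_coeff P \<notin> I" and t: "t \<in> A"
  obtains z where "z \<in> A" "poly P z - t \<in> I"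
proof -
  define c d where "c = lead_coeff P" and "d = degree P"
  have c: "c \<in> A" using P(1) by (simp add: c_def polys_over_def)
  obtain u where u: "u \<in> A" "u * c - 1 \<in> I" using inverse_mod[OF c] P(3) c_def by blast
  \<comment> \<open>The polynomial \<open>u * (P - t)\<close> is monic only modulo \<open>I\<close>; the term with \<open>e\<close> makes it monic without
    changing it modulo \<open>I\<close>.\<close>
  define e where "e = 1 - u * c"
  have e: "e \<in> I" using diff_commute[OF u(2)] by (simp add: e_def)
  define G where "G = Polynomial.smult u P + monom e d - [:u * t:]"
  interpret P: subring_set "polys_over A" by (rule subring_set_polys_over)
  have G: "G \<in> polys_over A" unfolding G_def
    using u P(1) t e
    by (intro P.add_closed P.diff_closed smult_in_polys_over monom_in_polys_over
        const_in_polys_over mult_closed) (auto simp: in_ring)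
  have "coeff G d = 1"
    using P(2) by (simp add: G_def e_def d_def c_def coeff_pCons split: nat.split)
  moreover have "degree G \<le> d"
    unfolding G_def d_def
    by (intro degree_diff_le degree_add_le degree_smult_le degree_monom_le) auto
  ultimately have "degree G = d" by (metis le_degree le_antisym zero_neq_one)
  then obtain z where z: "z \<in> A" "poly G z = 0"
    using monic_root[OF _ G] \<open>coeff G d = 1\<close> P(2) by (auto simp: d_def)
  have "u * (poly P z - t) = - (e * z ^ d)"
    using z(2) by (simp add: G_def poly_monom algebra_simps eq_neg_iff_add_eq_0)
  then have "u * (poly P z - t) \<in> I"
    using e z(1) by (simp add: minus_mem absorb_right power_closed)
  moreover have "u \<notin> I"
    using u(2) c mem_cong[OF u(2)] absorb_right[OF _ c] proper by blast
  ultimately have "poly P z - t \<in> I"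
    using prime[of u] u(1) P(1) z(1) t by (auto intro!: diff_closed poly_in)
  then show ?thesis using that z(1) by blast
qed

text \<open>
  If the residue class of \<open>P\<close> is not constant, it takes the value \<open>1\<close>, because the residue field is
  algebraically closed.
\<close>

lemma nonzero_value_mod:
  assumes P: "P \<in> polys_over A" "P \<notin> polys_over I"
  obtains z where "z \<in> A" "poly P z \<notin> I"
proof -
  obtain Q where Q: "Q \<in> polys_over A" "P - Q \<in> polys_over I" "Q = 0 \<or> lead_coeff Q \<notin> I"
    using trim_mod[OF P(1)] by blast
  have "Q \<noteq> 0" using Q(2) P(2) by auto
  obtain z where z: "z \<in> A" "poly Q z \<notin> I"
  proof (cases "degree Q = 0")
    case True
    then obtain c where "Q = [:c:]" by (rule degree_eq_zeroE)
    then show ?thesis using that[of 0] Q(3) \<open>Q \<noteq> 0\<close> zero_closed by (auto split: if_splits)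
  next
    case False
    then obtain z where "z \<in> A" "poly Q z - 1 \<in> I"
      using solve_mod[OF Q(1) _ _ one_closed] Q(3) \<open>Q \<noteq> 0\<close> by blast
    then show ?thesis using that mem_cong proper by blast
  qed
  have "poly P z - poly Q z \<in> I" using poly_in_ideal[OF Q(2) z(1)] by simp
  then show ?thesis using that z mem_cong by blast
qed

end

lemma map_poly_polys_over:
  assumes "comm_ring_hom \<phi>" "\<phi> ` S \<subseteq> T" "p \<in> polys_over S"
  shows "map_poly \<phi> p \<in> polys_over T"
proof -
  interpret comm_ring_hom \<phi> by fact
  show ?thesis using assms by (auto simp: polys_over_def)
qed

text \<open>
  The hypothesis on \<open>p\<close> says that the class of the indeterminate is algebraic over the domain \<open>A/q\<close>,
  where \<open>q\<close> is the contraction of \<open>Q\<close>. A nonzero element \<open>f\<close> of the algebraic extension \<open>A[X]/Q\<close> has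
  a nonzero multiple \<open>e\<close> in \<open>A/q\<close>, and this is the statement. Otherwise \<open>Q\<close> and \<open>J = Q + (f)\<close> have the
  same contraction \<open>q\<close>. Let \<open>a\<close> and \<open>b\<close> be generators of \<open>Q\<close> and \<open>J\<close> over the fraction field. Then
  \<open>b\<close> is not in \<open>Q\<close>, as \<open>f\<close> is not, and \<open>b\<close> divides \<open>a\<close> up to denominators. The cofactor is then in
  the prime \<open>Q\<close>, so its degree is at least that of \<open>a\<close>, which contradicts that \<open>b\<close> has positive degree.
\<close>

lemma resultant_in_contraction:
  assumes Q: "prime_set (polys_over A) Q" and A: "subring_set A"
    and f: "f \<in> polys_over A" "f \<notin> Q" and p: "p \<in> Q" "p \<notin> polys_over {s \<in> A. [:s:] \<in> Q}"
  shows "\<exists>e\<in>A. [:e:] \<notin> Q \<and> (\<exists>x\<in>Q. \<exists>u\<in>polys_over A. [:e:] = x + u * f)"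
proof (rule ccontr)
  assume none: "\<not> ?thesis"
  interpret A: subring_set A by fact
  interpret Q: prime_set "polys_over A" Q by fact
  define q where "q = {s \<in> A. [:s:] \<in> Q}"
  have q_prime: "prime_set A q"
    unfolding q_def by (rule prime_set_contraction[OF A Q])
  interpret q: prime_set A q by (rule q_prime)
  have qQ: "polys_over q \<subseteq> Q"
    by (rule polys_over_contraction_subset[OF A Q.ideal_set_axioms]) (simp add: q_def)
  define J where "J = {x + u * f | x u. x \<in> Q \<and> u \<in> polys_over A}"
  have J: "ideal_set (polys_over A) J"
    unfolding J_def using f(1) by (rule Q.ideal_set_add_principal[OF Q.ideal_set_axioms])
  interpret J: ideal_set "polys_over A" J by (rule J)
  have QJ: "Q \<subseteq> J"
    unfolding J_def using Q.zero_closed by force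
  have fJ: "f \<in> J"
    unfolding J_def using Q.zero_mem Q.one_closed by force
  have contrQ: "[:s:] \<in> Q \<longleftrightarrow> s \<in> q" if "s \<in> A" for s using that by (simp add: q_def)
  have contrJ: "[:s:] \<in> J \<longleftrightarrow> s \<in> q" if "s \<in> A" for s
    using that none QJ unfolding J_def q_def by blast
  have notQ: "\<not> Q \<subseteq> polys_over q" using p by (auto simp: q_def)
  then have notJ: "\<not> J \<subseteq> polys_over q" using QJ by blast
  obtain a where a: "a \<in> Q" "degree a > 0" "lead_coeff a \<notin> q"
    "\<forall>h\<in>Q. degree h < degree a \<longrightarrow> h \<in> polys_over q"
    by (rule pseudo_generator[OF A q.ideal_set_axioms Q.ideal_set_axioms contrQ notQ])
  obtain b where b: "b \<in> J" "degree b > 0" "lead_coeff b \<notin> q"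
    "\<forall>h\<in>J. \<exists>k. \<exists>t\<in>polys_over A. Polynomial.smult (lead_coeff b ^ k) h - t * b \<in> polys_over q"
    by (rule pseudo_generator[OF A q.ideal_set_axioms J contrJ notJ])
  let ?c = "lead_coeff b"
  have c: "?c \<in> A" using J.in_ring[OF b(1)] by (simp add: polys_over_def)
  have ck: "?c ^ k \<in> A" "?c ^ k \<notin> q" for k
    using A.power_closed[OF c] q.power_notin[OF c b(3)] by auto
  have "b \<notin> Q"
  proof
    assume "b \<in> Q"
    obtain k t where kt: "t \<in> polys_over A" "Polynomial.smult (?c ^ k) f - t * b \<in> polys_over q"
      using b(4) fJ by blast
    have "t * b \<in> Q" using kt(1) \<open>b \<in> Q\<close> by (rule Q.absorb)
    then have "[:?c ^ k:] * f \<in> Q" using kt(2) qQ Q.mem_cong by auto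
    then show False
      using Q.prime[of "[:?c ^ k:]" f] f ck contrQ A.const_in_polys_over by blast
  qed
  obtain k t where kt: "t \<in> polys_over A" "Polynomial.smult (?c ^ k) a - t * b \<in> polys_over q"
    using b(4) a(1) QJ by blast
  have "[:?c ^ k:] * a \<in> Q" using a(1) ck A.const_in_polys_over by (intro Q.absorb) auto
  then have "t * b \<in> Q" using kt(2) qQ Q.mem_cong by auto
  then have "t \<in> Q" using Q.prime[OF kt(1) J.in_ring[OF b(1)]] \<open>b \<notin> Q\<close> by blast
  obtain t' where t': "t' \<in> polys_over A" "t - t' \<in> polys_over q" "t' = 0 \<or> lead_coeff t' \<notin> q"
    using q.trim_mod[OF kt(1)] by blast
  interpret qX: ideal_set "polys_over A" "polys_over q"
    by (rule A.ideal_set_polys_over[OF q.ideal_set_axioms])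
  have "(t - t') * b \<in> polys_over q" using t'(2) J.in_ring[OF b(1)] by (rule qX.absorb_right)
  from qX.add_mem[OF kt(2) this]
  have diff: "Polynomial.smult (?c ^ k) a - t' * b \<in> polys_over q" by (simp add: algebra_simps)
  have "t' \<noteq> 0"
  proof
    assume "t' = 0"
    then have "?c ^ k * lead_coeff a \<in> q" using diff by (auto simp: polys_over_def)
    then show False
      using q.prime[OF ck(1)] ck(2) a(3) Q.in_ring[OF a(1)] by (auto simp: polys_over_def)
  qed
  then have t'lead: "lead_coeff t' \<notin> q" using t'(3) by blast
  have "t' \<in> Q" using \<open>t \<in> Q\<close> t'(2) qQ Q.mem_cong by blast
  have "degree a \<le> degree t'"
  proof (rule ccontr)
    assume "\<not> ?thesis"
    then have "t' \<in> polys_over q" using a(4) \<open>t' \<in> Q\<close> by auto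
    then show False using t'lead by (simp add: polys_over_def)
  qed
  then have "coeff (Polynomial.smult (?c ^ k) a - t' * b) (degree t' + degree b) = - (lead_coeff t' * ?c)"
    using b(2) by (simp add: coeff_mult_degree_sum coeff_eq_0)
  then have "lead_coeff t' * ?c \<in> q"
    using diff q.minus_mem by (metis minus_minus polys_over_coeff)
  then show False
    using q.prime[OF _ c] t'lead b(3) t'(1) by (auto simp: polys_over_def)
qed

text \<open>
  The extension theorem for a ring \<open>A[X]/Q\<close> generated by one element over \<open>A/q\<close>, where \<open>q\<close> is the
  contraction of \<open>Q\<close>: homomorphisms of \<open>A/q\<close> into an algebraically closed field \<open>T/M\<close> that do not
  kill \<open>g\<close> extend to homomorphisms of \<open>A[X]/Q\<close> that do not kill \<open>f\<close>. Here \<open>z\<close> represents the image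
  of \<open>X\<close>. The element \<open>g\<close> is chosen before \<open>\<phi>\<close>, so that the theorem can be iterated.
\<close>

lemma hom_extends_to_adjoined_element:
  assumes A: "subring_set (A :: 'r::comm_ring_1 set)" and Q: "prime_set (polys_over A) Q"
    and f: "f \<in> polys_over A" "f \<notin> Q"
  shows "\<exists>g\<in>A. [:g:] \<notin> Q \<and>
    (\<forall>(\<phi> :: 'r \<Rightarrow> 's::comm_ring_1) T M. comm_ring_hom \<phi> \<longrightarrow> alg_closed_residue T M \<longrightarrow> \<phi> ` A \<subseteq> T \<longrightarrow>
      (\<forall>s\<in>A. [:s:] \<in> Q \<longrightarrow> \<phi> s \<in> M) \<longrightarrow> \<phi> g \<notin> M \<longrightarrow>
      (\<exists>z\<in>T. (\<forall>h\<in>Q. poly (map_poly \<phi> h) z \<in> M) \<and> poly (map_poly \<phi> f) z \<notin> M))"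
proof -
  interpret A: subring_set A by fact
  interpret Q: prime_set "polys_over A" Q by fact
  define q where "q = {s \<in> A. [:s:] \<in> Q}"
  have q: "ideal_set A q"
    unfolding q_def by (rule ideal_set_contraction[OF A Q.ideal_set_axioms])
  interpret q: ideal_set A q by (rule q)
  have qQ: "polys_over q \<subseteq> Q"
    by (rule polys_over_contraction_subset[OF A Q.ideal_set_axioms]) (simp add: q_def)
  show ?thesis
  proof (cases "Q \<subseteq> polys_over q")

    case True
    \<comment> \<open>Here \<open>X\<close> is transcendental over \<open>A/q\<close>: any \<open>z\<close> that is not a root of the image of \<open>f\<close> will do.\<close>
    have "f \<notin> polys_over q" using f(2) qQ by blast
    then obtain n where n: "coeff f n \<notin> q" by (auto simp: polys_over_def)
    show ?thesis
    proof (intro bexI[of _ "coeff f n"] conjI allI impI)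
      show "coeff f n \<in> A" using f(1) by (rule polys_over_coeff)
      then show "[:coeff f n:] \<notin> Q" using n by (simp add: q_def)
      fix \<phi> :: "'r \<Rightarrow> 's" and T M
      assume \<phi>: "comm_ring_hom \<phi>" and TM: "alg_closed_residue T M" and AT: "\<phi> ` A \<subseteq> T"
        and kill: "\<forall>s\<in>A. [:s:] \<in> Q \<longrightarrow> \<phi> s \<in> M" and ne: "\<phi> (coeff f n) \<notin> M"
      interpret \<phi>: comm_ring_hom \<phi> by fact
      interpret M: alg_closed_residue T M by fact
      have "map_poly \<phi> f \<in> polys_over T" using \<phi> AT f(1) by (rule map_poly_polys_over)
      moreover have "map_poly \<phi> f \<notin> polys_over M"
        using ne by (auto simp: polys_over_def)
      ultimately obtain z where z: "z \<in> T" "poly (map_poly \<phi> f) z \<notin> M"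
        by (rule M.nonzero_value_mod)
      have "poly (map_poly \<phi> h) z \<in> M" if "h \<in> Q" for h
      proof -
        have "map_poly \<phi> h \<in> polys_over M"
          using that True kill by (intro map_poly_polys_over[OF \<phi>, of q]) (auto simp: q_def)
        then show ?thesis using z(1) by (rule M.poly_in_ideal)
      qed
      then show "\<exists>z\<in>T. (\<forall>h\<in>Q. poly (map_poly \<phi> h) z \<in> M) \<and> poly (map_poly \<phi> f) z \<notin> M"
        using z by blast
    qed
  next
    case False
    \<comment> \<open>Here \<open>X\<close> is algebraic, and \<open>z\<close> has to be a root of the image of the generator \<open>p\<close> of \<open>Q\<close>. If the
      leading coefficient of \<open>p\<close> survives, all of \<open>Q\<close> vanishes at \<open>z\<close>, and if the multiple \<open>e\<close> of \<open>f\<close>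
      survives, so does \<open>f\<close>.\<close>
    then obtain p0 where p0: "p0 \<in> Q" "p0 \<notin> polys_over q" by blast
    obtain e x u where e: "e \<in> A" "[:e:] \<notin> Q" "x \<in> Q" "u \<in> polys_over A" "[:e:] = x + u * f"
      using resultant_in_contraction[OF Q A f p0(1)] p0(2) by (auto simp: q_def)
    have contr: "[:s:] \<in> Q \<longleftrightarrow> s \<in> q" if "s \<in> A" for s using that by (simp add: q_def)
    obtain p where p: "p \<in> Q" "degree p > 0" "lead_coeff p \<notin> q"
      "\<forall>h\<in>Q. \<exists>k. \<exists>t\<in>polys_over A. Polynomial.smult (lead_coeff p ^ k) h - t * p \<in> polys_over q"
      by (rule pseudo_generator[OF A q Q.ideal_set_axioms contr False])
    let ?c = "lead_coeff p"
    have c: "?c \<in> A" using Q.in_ring[OF p(1)] by (rule polys_over_coeff)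
    show ?thesis
    proof (intro bexI[of _ "?c * e"] conjI allI impI)
      show "?c * e \<in> A" using c e(1) by (rule A.mult_closed)
      show "[:?c * e:] \<notin> Q"
        using Q.prime[of "[:?c:]" "[:e:]"] c e(1,2) p(3) contr
        by (auto simp: A.const_in_polys_over mult.commute)
      fix \<phi> :: "'r \<Rightarrow> 's" and T M
      assume \<phi>: "comm_ring_hom \<phi>" and TM: "alg_closed_residue T M" and AT: "\<phi> ` A \<subseteq> T"
        and kill: "\<forall>s\<in>A. [:s:] \<in> Q \<longrightarrow> \<phi> s \<in> M" and ne: "\<phi> (?c * e) \<notin> M"
      interpret \<phi>: comm_ring_hom \<phi> by fact
      interpret \<Phi>: map_poly_comm_ring_hom \<phi> ..
      interpret M: alg_closed_residue T M by fact
      have mapT: "map_poly \<phi> h \<in> polys_over T" if "h \<in> polys_over A" for h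
        using \<phi> AT that by (rule map_poly_polys_over)
      have mapM: "map_poly \<phi> h \<in> polys_over M" if "h \<in> polys_over q" for h
        using that kill by (intro map_poly_polys_over[OF \<phi>, of q]) (auto simp: q_def)
      have cM: "\<phi> ?c \<notin> M" and eM: "\<phi> e \<notin> M"
        using ne M.absorb[of "\<phi> e" "\<phi> ?c"] M.absorb[of "\<phi> ?c" "\<phi> e"] AT c e(1)
        by (auto simp: \<phi>.hom_mult mult.commute)
      then have "\<phi> ?c \<noteq> 0" using M.zero_mem by auto
      then have deg: "degree (map_poly \<phi> p) = degree p"
        by (intro antisym degree_map_poly_le le_degree) simp
      obtain z where z: "z \<in> T" "poly (map_poly \<phi> p) z - 0 \<in> M"
        using M.solve_mod[OF mapT[OF Q.in_ring[OF p(1)]] _ _ M.zero_closed] p(2) cM deg by auto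
      have Qz: "poly (map_poly \<phi> h) z \<in> M" if h: "h \<in> Q" for h
      proof -
        obtain k t where kt: "t \<in> polys_over A" "Polynomial.smult (?c ^ k) h - t * p \<in> polys_over q"
          using p(4) h by blast
        have "poly (map_poly \<phi> (Polynomial.smult (?c ^ k) h - t * p)) z \<in> M"
          using M.poly_in_ideal[OF mapM[OF kt(2)] z(1)] .
        moreover have "poly (map_poly \<phi> t) z * poly (map_poly \<phi> p) z \<in> M"
          using z mapT[OF kt(1)] by (intro M.absorb M.poly_in) auto
        ultimately have "\<phi> ?c ^ k * poly (map_poly \<phi> h) z \<in> M"
          using M.mem_cong
          by (simp add: \<Phi>.hom_minus \<Phi>.hom_mult \<phi>.map_poly_hom_smult \<phi>.hom_power)
        moreover have "\<phi> ?c ^ k \<in> T" "\<phi> ?c ^ k \<notin> M"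
          using c AT cM M.power_notin M.power_closed by blast+
        ultimately show ?thesis
          using M.prime M.poly_in[OF mapT[OF Q.in_ring[OF h]] z(1)] by blast
      qed
      have "poly (map_poly \<phi> f) z \<notin> M"
      proof
        assume "poly (map_poly \<phi> f) z \<in> M"
        then have "poly (map_poly \<phi> x) z + poly (map_poly \<phi> u) z * poly (map_poly \<phi> f) z \<in> M"
          using Qz e(3,4) mapT z(1) by (intro M.add_mem M.absorb M.poly_in) auto
        also have "poly (map_poly \<phi> x) z + poly (map_poly \<phi> u) z * poly (map_poly \<phi> f) z =
            poly (map_poly \<phi> [:e:]) z"
          by (simp only: e(5) \<Phi>.hom_add \<Phi>.hom_mult poly_add poly_mult)
        finally show False using eM by (simp add: \<phi>.map_poly_pCons_hom)
      qed
      then show "\<exists>z\<in>T. (\<forall>h\<in>Q. poly (map_poly \<phi> h) z \<in> M) \<and> poly (map_poly \<phi> f) z \<notin> M"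
        using z(1) Qz by blast
    qed
  qed
qed

section \<open>Multivariate polynomials\<close>

definition eval_monom :: "(nat \<Rightarrow> 's::comm_ring_1) \<Rightarrow> (nat \<Rightarrow>\<^sub>0 nat) \<Rightarrow> 's" where
  "eval_monom a m = (\<Prod>i\<in>Poly_Mapping.keys m. a i ^ Poly_Mapping.lookup m i)"

text \<open>
  The coefficients are mapped by an arbitrary homomorphism, since besides the evaluation at points
  of the algebraic closure also the substitution of univariate polynomials is needed.
\<close>

definition eval_mpoly :: "('r::comm_ring_1 \<Rightarrow> 's::comm_ring_1) \<Rightarrow> (nat \<Rightarrow> 's) \<Rightarrow> 'r mpoly \<Rightarrow> 's" where
  "eval_mpoly \<phi> a p = (\<Sum>m\<in>Poly_Mapping.keys p. \<phi> (Poly_Mapping.lookup p m) * eval_monom a m)"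

lemma mpoly_eval_conv: "mpoly_eval p a = eval_mpoly to_closure a p"
  by (simp add: mpoly_eval_def eval_mpoly_def eval_monom_def)

lemma eval_monom_superset:
  assumes "finite K" "Poly_Mapping.keys m \<subseteq> K"
  shows "eval_monom a m = (\<Prod>i\<in>K. a i ^ Poly_Mapping.lookup m i)"
  unfolding eval_monom_def using assms
  by (intro prod.mono_neutral_left) (auto simp: in_keys_iff)

lemma eval_monom_add: "eval_monom a (k + l) = eval_monom a k * eval_monom a l"
proof -
  let ?K = "Poly_Mapping.keys k \<union> Poly_Mapping.keys l"
  have "eval_monom a (k + l) = (\<Prod>i\<in>?K. a i ^ Poly_Mapping.lookup (k + l) i)"
    by (intro eval_monom_superset keys_add) auto
  also have "\<dots> = (\<Prod>i\<in>?K. a i ^ Poly_Mapping.lookup k i) * (\<Prod>i\<in>?K. a i ^ Poly_Mapping.lookup l i)"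
    by (simp add: lookup_add power_add prod.distrib)
  also have "\<dots> = eval_monom a k * eval_monom a l"
    by (simp add: eval_monom_superset[of ?K])
  finally show ?thesis .
qed

lemma mpoly_as_sum: "p = (\<Sum>m\<in>Poly_Mapping.keys p. Poly_Mapping.single m (Poly_Mapping.lookup p m))"
proof (rule poly_mapping_eqI)
  fix k
  show "Poly_Mapping.lookup p k =
      Poly_Mapping.lookup (\<Sum>m\<in>Poly_Mapping.keys p. Poly_Mapping.single m (Poly_Mapping.lookup p m)) k"
    by (auto simp: lookup_sum lookup_single when_def in_keys_iff)
qed

abbreviation mconst :: "'r::comm_ring_1 \<Rightarrow> 'r mpoly" where
  "mconst \<equiv> Poly_Mapping.single 0"

definition mvar :: "nat \<Rightarrow> 'r::comm_ring_1 mpoly" where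
  "mvar i = Poly_Mapping.single (Poly_Mapping.single i 1) 1"

context comm_ring_hom
begin

lemma eval_mpoly_superset:
  assumes "finite K" "Poly_Mapping.keys p \<subseteq> K"
  shows "eval_mpoly hom a p = (\<Sum>m\<in>K. hom (Poly_Mapping.lookup p m) * eval_monom a m)"
  unfolding eval_mpoly_def using assms
  by (intro sum.mono_neutral_left) (auto simp: in_keys_iff)

lemma eval_mpoly_add: "eval_mpoly hom a (p + q) = eval_mpoly hom a p + eval_mpoly hom a q"
proof -
  let ?K = "Poly_Mapping.keys p \<union> Poly_Mapping.keys q"
  have "eval_mpoly hom a (p + q) = (\<Sum>m\<in>?K. hom (Poly_Mapping.lookup (p + q) m) * eval_monom a m)"
    by (intro eval_mpoly_superset keys_add) auto
  also have "\<dots> = eval_mpoly hom a p + eval_mpoly hom a q"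
    by (simp add: lookup_add hom_add distrib_right sum.distrib eval_mpoly_superset[of ?K])
  finally show ?thesis .
qed

lemma eval_mpoly_zero: "eval_mpoly hom a 0 = 0"
  by (simp add: eval_mpoly_def)

lemma eval_mpoly_sum: "eval_mpoly hom a (sum f K) = (\<Sum>i\<in>K. eval_mpoly hom a (f i))"
  by (induction K rule: infinite_finite_induct) (simp_all add: eval_mpoly_zero eval_mpoly_add)

lemma eval_mpoly_single: "eval_mpoly hom a (Poly_Mapping.single m c) = hom c * eval_monom a m"
  by (simp add: eval_mpoly_superset[of "{m}"])

lemma eval_mpoly_mult: "eval_mpoly hom a (p * q) = eval_mpoly hom a p * eval_mpoly hom a q"
proof -
  have "p * q = (\<Sum>k\<in>Poly_Mapping.keys p. \<Sum>l\<in>Poly_Mapping.keys q.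
      Poly_Mapping.single (k + l) (Poly_Mapping.lookup p k * Poly_Mapping.lookup q l))"
    by (subst mpoly_as_sum[of p], subst mpoly_as_sum[of q]) (simp add: sum_product mult_single)
  then show ?thesis
    by (simp add: eval_mpoly_sum eval_mpoly_single eval_monom_add hom_mult mult_ac
        eval_mpoly_def[of _ _ p] eval_mpoly_def[of _ _ q] sum_product)
qed

lemma comm_ring_hom_eval_mpoly: "comm_ring_hom (eval_mpoly hom a)"
proof
  show "eval_mpoly hom a 1 = 1"
    using eval_mpoly_single[of a 0 1] by (simp add: eval_monom_def)
qed (simp_all add: eval_mpoly_zero eval_mpoly_add eval_mpoly_mult)

lemma eval_mpoly_mconst: "eval_mpoly hom a (mconst c) = hom c"
  by (simp add: eval_mpoly_single eval_monom_def)

lemma eval_mpoly_mvar: "eval_mpoly hom a (mvar i) = a i"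
  by (simp add: mvar_def eval_mpoly_single eval_monom_def)

end

definition mpolys_in :: "nat \<Rightarrow> 'r::comm_ring_1 mpoly set" where
  "mpolys_in N = {p. \<forall>m\<in>Poly_Mapping.keys p. Poly_Mapping.keys m \<subseteq> {..<N}}"

lemma mpoly_ring_conv: "mpoly_ring N = ring_on (mpolys_in N)"
  by (simp add: mpoly_ring_def mpolys_in_def)

lemma single_in_mpolys_in:
  "Poly_Mapping.keys m \<subseteq> {..<N} \<Longrightarrow> Poly_Mapping.single m c \<in> mpolys_in N"
  by (auto simp: mpolys_in_def split: if_splits)

lemma mconst_in: "mconst c \<in> mpolys_in N"
  by (rule single_in_mpolys_in) simp

lemma mvar_in: "i < N \<Longrightarrow> mvar i \<in> mpolys_in N"
  unfolding mvar_def by (rule single_in_mpolys_in) simp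

lemma subring_set_mpolys_in: "subring_set (mpolys_in N)"
proof
  show "1 \<in> mpolys_in N" using mconst_in[of 1] by simp
  fix p q :: "'a mpoly" assume pq: "p \<in> mpolys_in N" "q \<in> mpolys_in N"
  have "Poly_Mapping.keys (p - q) \<subseteq> Poly_Mapping.keys p \<union> Poly_Mapping.keys q"
    by (auto simp: in_keys_iff lookup_minus)
  then show "p - q \<in> mpolys_in N" using pq by (auto simp: mpolys_in_def)
  show "p * q \<in> mpolys_in N" unfolding mpolys_in_def
  proof (intro CollectI ballI)
    fix m assume "m \<in> Poly_Mapping.keys (p * q)"
    then obtain k l where "m = k + l" "k \<in> Poly_Mapping.keys p" "l \<in> Poly_Mapping.keys q"
      using keys_mult by blast
    then show "Poly_Mapping.keys m \<subseteq> {..<N}"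
      using pq keys_add[of k l] by (fastforce simp: mpolys_in_def)
  qed
qed

lemma mpolys_in_mono: "N \<le> N' \<Longrightarrow> mpolys_in N \<subseteq> mpolys_in N'"
  by (force simp: mpolys_in_def)

lemma mpolys_in_0: "p \<in> mpolys_in 0 \<longleftrightarrow> (\<exists>c. p = mconst c)"
proof
  assume "p \<in> mpolys_in 0"
  then have "Poly_Mapping.keys p \<subseteq> {0}" by (auto simp: mpolys_in_def)
  then have "p = mconst (Poly_Mapping.lookup p 0)"
    by (intro poly_mapping_eqI) (auto simp: lookup_single when_def in_keys_iff)
  then show "\<exists>c. p = mconst c" ..
qed (auto simp: mconst_in)

lemma mvar_power: "mvar i ^ k = Poly_Mapping.single (Poly_Mapping.single i k) 1"
  by (induction k) (simp_all add: mvar_def mult_single single_add[symmetric])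

text \<open>
  Splitting off the last indeterminate, which sets up the induction on the number of variables.
\<close>

lemma mpolys_in_Suc:
  "p \<in> mpolys_in (Suc N) \<longleftrightarrow> (\<exists>P\<in>polys_over (mpolys_in N). p = poly P (mvar N))"
proof
  assume p: "p \<in> mpolys_in (Suc N)"
  interpret S: subring_set "mpolys_in N" by (rule subring_set_mpolys_in)
  interpret P: subring_set "polys_over (mpolys_in N)" by (rule S.subring_set_polys_over)
  have "\<exists>P. P \<in> polys_over (mpolys_in N) \<and> Poly_Mapping.single m c = poly P (mvar N)"
    if m: "m \<in> Poly_Mapping.keys p" for m c
  proof -
    define k where "k = Poly_Mapping.lookup m N"
    define m' where "m' = m - Poly_Mapping.single N k"
    have "m = m' + Poly_Mapping.single N k"
      by (intro poly_mapping_eqI) (auto simp: m'_def k_def lookup_add lookup_minus lookup_single when_def)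
    then have "Poly_Mapping.single m c = Poly_Mapping.single m' c * mvar N ^ k"
      unfolding mvar_power by (simp add: mult_single)
    moreover have "Poly_Mapping.keys m' \<subseteq> {..<N}"
    proof
      fix i assume "i \<in> Poly_Mapping.keys m'"
      then have "i \<noteq> N" "i \<in> Poly_Mapping.keys m"
        by (auto simp: m'_def k_def in_keys_iff lookup_minus lookup_single when_def split: if_splits)
      then show "i \<in> {..<N}" using p m by (fastforce simp: mpolys_in_def)
    qed
    then have "monom (Poly_Mapping.single m' c) k \<in> polys_over (mpolys_in N)"
      by (intro S.monom_in_polys_over single_in_mpolys_in)
    ultimately show ?thesis
      by (intro exI[of _ "monom (Poly_Mapping.single m' c) k"]) (simp add: poly_monom)
  qed
  then have "\<forall>m\<in>Poly_Mapping.keys p. \<exists>P. P \<in> polys_over (mpolys_in N) \<and>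
      Poly_Mapping.single m (Poly_Mapping.lookup p m) = poly P (mvar N)"
    by blast
  from bchoice[OF this] obtain F where F: "\<forall>m\<in>Poly_Mapping.keys p. F m \<in> polys_over (mpolys_in N) \<and>
      Poly_Mapping.single m (Poly_Mapping.lookup p m) = poly (F m) (mvar N)"
    by (elim exE)
  have "p = poly (\<Sum>m\<in>Poly_Mapping.keys p. F m) (mvar N)"
    by (subst mpoly_as_sum) (simp add: F poly_sum)
  moreover have "(\<Sum>m\<in>Poly_Mapping.keys p. F m) \<in> polys_over (mpolys_in N)"
    using F by (intro P.sum_closed) blast
  ultimately show "\<exists>P\<in>polys_over (mpolys_in N). p = poly P (mvar N)" by (intro bexI)
next
  interpret S: subring_set "mpolys_in (Suc N)" by (rule subring_set_mpolys_in)
  assume "\<exists>P\<in>polys_over (mpolys_in N). p = poly P (mvar N)"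
  then show "p \<in> mpolys_in (Suc N)"
    using polys_over_mono[OF mpolys_in_mono[of N "Suc N"]] S.poly_in[OF _ mvar_in] by auto
qed

lemma eval_mpoly_cong:
  assumes "p \<in> mpolys_in N" "\<And>i. i < N \<Longrightarrow> a i = b i"
  shows "eval_mpoly \<phi> a p = eval_mpoly \<phi> b p"
  unfolding eval_mpoly_def eval_monom_def using assms
  by (intro sum.cong prod.cong arg_cong2[of _ _ _ _ "(*)"] arg_cong2[of _ _ _ _ "(^)"] refl)
    (auto simp: mpolys_in_def)

lemma eval_mpoly_in:
  assumes "subring_set T" "range \<phi> \<subseteq> T" "\<And>i. a i \<in> T"
  shows "eval_mpoly \<phi> a p \<in> T"
proof -
  interpret subring_set T by fact
  show ?thesis unfolding eval_mpoly_def eval_monom_def using assms by (auto intro!: closed)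
qed

text \<open>
  The extension theorem for several variables, by eliminating the last one: apply the theorem for
  one variable over \<open>mpolys_in N\<close>, and the induction hypothesis to the resulting element \<open>g\<close> and to
  the contraction of \<open>Q\<close>. A homomorphism on the polynomial ring is given by the point \<open>a\<close> at which it
  evaluates.
\<close>

lemma specialization_avoiding:
  assumes "prime_set (mpolys_in N) Q" "f \<in> mpolys_in N" "f \<notin> Q"
  shows "\<exists>r :: 'r::comm_ring_1. mconst r \<notin> Q \<and>
    (\<forall>(\<phi> :: 'r \<Rightarrow> 's::comm_ring_1) T M. comm_ring_hom \<phi> \<longrightarrow> alg_closed_residue T M \<longrightarrow> range \<phi> \<subseteq> T \<longrightarrow>
      (\<forall>s. mconst s \<in> Q \<longrightarrow> \<phi> s \<in> M) \<longrightarrow> \<phi> r \<notin> M \<longrightarrow>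
      (\<exists>a. range a \<subseteq> T \<and> (\<forall>h\<in>Q. eval_mpoly \<phi> a h \<in> M) \<and> eval_mpoly \<phi> a f \<notin> M))"
  using assms
proof (induction N arbitrary: Q f)
  case 0
  interpret Q: prime_set "mpolys_in 0" Q by fact
  obtain r where r: "f = mconst r" using 0 mpolys_in_0 by blast
  show ?case
  proof (intro exI[of _ r] conjI allI impI)
    show "mconst r \<notin> Q" using 0 r by simp
    fix \<phi> :: "'r \<Rightarrow> 's" and T M
    assume \<phi>: "comm_ring_hom \<phi>" "alg_closed_residue T M" "range \<phi> \<subseteq> T"
      and kill: "\<forall>s. mconst s \<in> Q \<longrightarrow> \<phi> s \<in> M" and "\<phi> r \<notin> M"
    interpret \<phi>: comm_ring_hom \<phi> by fact
    interpret T: alg_closed_residue T M by fact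
    have "eval_mpoly \<phi> (\<lambda>_. 0) h \<in> M" if "h \<in> Q" for h
      using that Q.in_ring[OF that] kill by (auto simp: mpolys_in_0 \<phi>.eval_mpoly_mconst)
    then show "\<exists>a. range a \<subseteq> T \<and> (\<forall>h\<in>Q. eval_mpoly \<phi> a h \<in> M) \<and> eval_mpoly \<phi> a f \<notin> M"
      using \<open>\<phi> r \<notin> M\<close> T.zero_closed
      by (intro exI[of _ "\<lambda>_. 0"]) (auto simp: r \<phi>.eval_mpoly_mconst)
  qed
next
  case (Suc N)
  interpret Q: prime_set "mpolys_in (Suc N)" Q by fact
  interpret S: subring_set "mpolys_in N :: 'r mpoly set" by (rule subring_set_mpolys_in)
  have sub: "(mpolys_in N :: 'r mpoly set) \<subseteq> mpolys_in (Suc N)" by (rule mpolys_in_mono) simp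
  let ?X = "mvar N :: 'r mpoly"
  have eval_in: "poly P ?X \<in> mpolys_in (Suc N)" if "P \<in> polys_over (mpolys_in N)" for P
    using that mpolys_in_Suc by blast
  define Q1 where "Q1 = {P \<in> polys_over (mpolys_in N). poly P ?X \<in> Q}"
  have Q1: "prime_set (polys_over (mpolys_in N)) Q1"
  proof -
    interpret P: subring_set "polys_over (mpolys_in N :: 'r mpoly set)" by (rule S.subring_set_polys_over)
    show ?thesis
      using Q.one_notin Q.zero_mem Q.add_mem Q.absorb Q.prime eval_in
      by unfold_locales (auto simp: Q1_def P.closed)
  qed
  define Q0 where "Q0 = Q \<inter> mpolys_in N"
  have Q0: "prime_set (mpolys_in N) Q0"
    using Q.one_notin Q.zero_mem Q.add_mem Q.absorb[OF subsetD[OF sub]]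
      Q.prime[OF subsetD[OF sub] subsetD[OF sub]]
    by unfold_locales (auto simp: Q0_def S.closed)
  obtain F where F: "F \<in> polys_over (mpolys_in N)" "f = poly F ?X"
    using Suc.prems(2) mpolys_in_Suc by blast
  have "F \<notin> Q1" using Suc.prems(3) F by (simp add: Q1_def)
  from hom_extends_to_adjoined_element[OF subring_set_mpolys_in Q1 F(1) \<open>F \<notin> Q1\<close>]
  obtain g where g: "g \<in> mpolys_in N" "[:g:] \<notin> Q1" and
    ext: "\<forall>(\<phi> :: 'r mpoly \<Rightarrow> 's) T M. comm_ring_hom \<phi> \<longrightarrow> alg_closed_residue T M \<longrightarrow>
      \<phi> ` mpolys_in N \<subseteq> T \<longrightarrow> (\<forall>s\<in>mpolys_in N. [:s:] \<in> Q1 \<longrightarrow> \<phi> s \<in> M) \<longrightarrow> \<phi> g \<notin> M \<longrightarrow>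
      (\<exists>z\<in>T. (\<forall>h\<in>Q1. poly (map_poly \<phi> h) z \<in> M) \<and> poly (map_poly \<phi> F) z \<notin> M)"
    by (elim bexE conjE)
  have const_Q1: "[:s:] \<in> Q1 \<longleftrightarrow> s \<in> Q0" if "s \<in> mpolys_in N" for s
    using that by (simp add: Q1_def Q0_def S.const_in_polys_over)
  have "g \<notin> Q0" using g const_Q1 by blast
  from Suc.IH[OF Q0 g(1) this] obtain r where r: "mconst r \<notin> Q0" and
    special: "\<forall>(\<phi> :: 'r \<Rightarrow> 's) T M. comm_ring_hom \<phi> \<longrightarrow> alg_closed_residue T M \<longrightarrow> range \<phi> \<subseteq> T \<longrightarrow>
      (\<forall>s. mconst s \<in> Q0 \<longrightarrow> \<phi> s \<in> M) \<longrightarrow> \<phi> r \<notin> M \<longrightarrow>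
      (\<exists>a. range a \<subseteq> T \<and> (\<forall>h\<in>Q0. eval_mpoly \<phi> a h \<in> M) \<and> eval_mpoly \<phi> a g \<notin> M)"
    by (elim exE conjE)
  show ?case
  proof (intro exI[of _ r] conjI allI impI)
    show "mconst r \<notin> Q" using r mconst_in by (auto simp: Q0_def)
    fix \<phi> :: "'r \<Rightarrow> 's" and T M
    assume \<phi>: "comm_ring_hom \<phi>" "alg_closed_residue T M" "range \<phi> \<subseteq> T"
      and kill: "\<forall>s. mconst s \<in> Q \<longrightarrow> \<phi> s \<in> M" and "\<phi> r \<notin> M"
    interpret \<phi>: comm_ring_hom \<phi> by fact
    interpret T: alg_closed_residue T M by fact
    obtain a where a: "range a \<subseteq> T" "\<And>h. h \<in> Q0 \<Longrightarrow> eval_mpoly \<phi> a h \<in> M" "eval_mpoly \<phi> a g \<notin> M"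
      using special[THEN spec, THEN spec, THEN spec, THEN mp, OF \<phi>(1), THEN mp, OF \<phi>(2),
          THEN mp, OF \<phi>(3)] \<open>\<phi> r \<notin> M\<close> kill by (auto simp: Q0_def)
    have "eval_mpoly \<phi> a ` mpolys_in N \<subseteq> T"
      using eval_mpoly_in[OF T.subring_set_axioms \<phi>(3)] a(1) by blast
    moreover have "\<forall>s\<in>mpolys_in N. [:s:] \<in> Q1 \<longrightarrow> eval_mpoly \<phi> a s \<in> M"
      using a(2) const_Q1 by blast
    ultimately have "\<exists>z\<in>T. (\<forall>h\<in>Q1. poly (map_poly (eval_mpoly \<phi> a) h) z \<in> M) \<and>
        poly (map_poly (eval_mpoly \<phi> a) F) z \<notin> M"
      using ext[THEN spec, THEN spec, THEN spec, THEN mp, OF \<phi>.comm_ring_hom_eval_mpoly,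
          THEN mp, OF \<phi>(2)] a(3) by blast
    then obtain z where z: "z \<in> T" "\<And>h. h \<in> Q1 \<Longrightarrow> poly (map_poly (eval_mpoly \<phi> a) h) z \<in> M"
      "poly (map_poly (eval_mpoly \<phi> a) F) z \<notin> M"
      by blast
    define b where "b = a(N := z)"
    interpret b: comm_ring_hom "eval_mpoly \<phi> b" by (rule \<phi>.comm_ring_hom_eval_mpoly)
    interpret a: comm_ring_hom "eval_mpoly \<phi> a" by (rule \<phi>.comm_ring_hom_eval_mpoly)
    have eval: "eval_mpoly \<phi> b (poly P ?X) = poly (map_poly (eval_mpoly \<phi> a) P) z"
      if P: "P \<in> polys_over (mpolys_in N)" for P
    proof -
      have "map_poly (eval_mpoly \<phi> a) P = map_poly (eval_mpoly \<phi> b) P"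
      proof (rule poly_eqI)
        fix n
        have "eval_mpoly \<phi> a (coeff P n) = eval_mpoly \<phi> b (coeff P n)"
          by (rule eval_mpoly_cong[OF polys_over_coeff[OF P]]) (simp add: b_def)
        then show "coeff (map_poly (eval_mpoly \<phi> a) P) n = coeff (map_poly (eval_mpoly \<phi> b) P) n"
          by simp
      qed
      moreover have "eval_mpoly \<phi> b ?X = z" using \<phi>.eval_mpoly_mvar[of b N] by (simp add: b_def)
      ultimately show ?thesis using b.poly_map_poly[of P ?X] by (simp only:)
    qed
    have "eval_mpoly \<phi> b h \<in> M" if "h \<in> Q" for h
    proof -
      obtain P where "P \<in> polys_over (mpolys_in N)" "h = poly P ?X"
        using Q.in_ring[OF \<open>h \<in> Q\<close>] mpolys_in_Suc by blast
      then show ?thesis using that z(2)[of P] eval by (simp add: Q1_def)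
    qed
    moreover have "eval_mpoly \<phi> b f \<notin> M" using F z(3) eval by simp
    moreover have "range b \<subseteq> T" using a(1) z(1) by (auto simp: b_def)
    ultimately show "\<exists>a. range a \<subseteq> T \<and> (\<forall>h\<in>Q. eval_mpoly \<phi> a h \<in> M) \<and> eval_mpoly \<phi> a f \<notin> M"
      by blast
  qed
qed

section \<open>The three implications\<close>

lemma alg_closed_residue_integral_closure:
  assumes "maximal_set integral_closure M"
  shows "alg_closed_residue integral_closure M"
proof -
  interpret maximal_set integral_closure M by fact
  show ?thesis using monic_has_integral_root by unfold_locales blast
qed

lemma integral_closure_ring_conv: "integral_closure_ring = ring_on integral_closure"
  by (simp add: integral_closure_ring_def)

text \<open>
  Were \<open>f 0\<close> not in the radical, there would be a prime \<open>Q\<close> that contains the other \<open>f j\<close> but not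
  \<open>f 0\<close>. Specialization gives \<open>r\<close> outside \<open>Q\<close>; being a Jacobson ring, \<open>'a\<close> has a maximal ideal \<open>m\<close>
  over the contraction of \<open>Q\<close> that avoids \<open>r\<close>. For a maximal ideal \<open>M\<close> of the integral closure over
  \<open>m\<close>, specialization gives a point at which \<open>f j\<close> takes a value in \<open>M\<close> for all \<open>j \<ge> 1\<close>, but \<open>f 0\<close>
  does not.
\<close>

lemma jacobson_imp_radical_membership:
  fixes f :: "nat \<Rightarrow> 'a::idom mpoly"
  assumes jacobson: "jacobson_ring (ring_of_type_algebra :: 'a ring)"
    and f: "\<forall>j\<le>n. f j \<in> mpolys_in N"
    and pointwise: "\<And>a. \<forall>i<N. a i \<in> integral_closure \<Longrightarrow>
      mpoly_eval (f 0) a \<in> ideal_radical (ring_on integral_closure)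
        (Idl\<^bsub>ring_on integral_closure\<^esub> ((\<lambda>j. mpoly_eval (f j) a) ` {1..n}))"
  shows "f 0 \<in> ideal_radical (ring_on (mpolys_in N)) (Idl\<^bsub>ring_on (mpolys_in N)\<^esub> (f ` {1..n}))"
proof (rule ccontr)
  assume not: "\<not> ?thesis"
  interpret S: subring_set "mpolys_in N :: 'a mpoly set" by (rule subring_set_mpolys_in)
  define I where "I = Idl\<^bsub>ring_on (mpolys_in N)\<^esub> (f ` {1..n})"
  have I: "ideal_set (mpolys_in N) I"
    unfolding I_def using f by (intro S.ideal_set_genideal) auto
  interpret I: ideal_set "mpolys_in N" I by (rule I)
  have f0: "f 0 \<in> mpolys_in N" using f by simp
  have powers: "f 0 ^ k \<notin> I" for k
  proof
    assume "f 0 ^ k \<in> I"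
    then have "f 0 ^ Suc k \<in> I" using I.absorb[OF f0] by simp
    then have "f 0 \<in> ideal_radical (ring_on (mpolys_in N)) I"
      using f0 by (auto simp: ideal_radical_def simp del: power_Suc intro: exI[of _ "Suc k"])
    then show False using not by (simp add: I_def)
  qed
  define W where "W = range (\<lambda>k. f 0 ^ k)"
  have W: "W \<subseteq> mpolys_in N" "1 \<in> W" "I \<inter> W = {}"
    using f0 powers S.power_closed range_eqI[of 1 "\<lambda>k. f 0 ^ k" 0] by (auto simp: W_def)
  have W_mult: "x * y \<in> W" if "x \<in> W" "y \<in> W" for x y
    using that by (auto simp: W_def power_add[symmetric])
  have "f 0 \<in> W" unfolding W_def by (rule range_eqI[of _ _ 1]) simp
  obtain Q where Q: "prime_set (mpolys_in N) Q" "I \<subseteq> Q" "Q \<inter> W = {}"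
    by (rule S.exists_prime_avoiding[OF I W(1,2) _ W(3)], erule (1) W_mult, rule that)
  interpret Q: prime_set "mpolys_in N" Q by (rule Q(1))
  have "f 0 \<notin> Q" using Q(3) \<open>f 0 \<in> W\<close> by blast
  obtain r where r: "mconst r \<notin> Q" and
    special: "\<forall>(\<phi> :: 'a \<Rightarrow> 'a fract alg_closure) T M. comm_ring_hom \<phi> \<longrightarrow> alg_closed_residue T M \<longrightarrow>
      range \<phi> \<subseteq> T \<longrightarrow> (\<forall>s. mconst s \<in> Q \<longrightarrow> \<phi> s \<in> M) \<longrightarrow> \<phi> r \<notin> M \<longrightarrow>
      (\<exists>a. range a \<subseteq> T \<and> (\<forall>h\<in>Q. eval_mpoly \<phi> a h \<in> M) \<and> eval_mpoly \<phi> a (f 0) \<notin> M)"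
    using specialization_avoiding[OF Q(1) f0 \<open>f 0 \<notin> Q\<close>] by blast
  have "prime_set UNIV {s. mconst s \<in> Q}"
    using Q.one_notin Q.zero_mem Q.add_mem Q.absorb[OF mconst_in] Q.prime[OF mconst_in mconst_in]
    by unfold_locales (auto simp: single_add mult_single[of 0 _ 0, simplified, symmetric])
  then obtain m where m: "maximal_set UNIV m" "{s. mconst s \<in> Q} \<subseteq> m" "r \<notin> m"
    using jacobson r unfolding jacobson_ring_type_iff by blast
  obtain M where M: "maximal_set integral_closure M" "\<And>s. to_closure s \<in> M \<longleftrightarrow> s \<in> m"
    by (rule maximal_lying_over[OF m(1)]) blast
  interpret M: maximal_set integral_closure M by (rule M(1))
  obtain a where a: "range a \<subseteq> integral_closure" "\<And>h. h \<in> Q \<Longrightarrow> mpoly_eval h a \<in> M"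
    "mpoly_eval (f 0) a \<notin> M"
    using special[rule_format, OF to_closure.comm_ring_hom_axioms
        alg_closed_residue_integral_closure[OF M(1)]] to_closure_integral m(2,3) M(2)
    unfolding mpoly_eval_conv by blast
  have "f ` {1..n} \<subseteq> Q" using S.genideal_superset[of "f ` {1..n}"] Q(2) by (simp add: I_def)
  then have "(\<lambda>j. mpoly_eval (f j) a) ` {1..n} \<subseteq> M" using a(2) by auto
  moreover have "\<forall>i<N. a i \<in> integral_closure" using a(1) by blast
  ultimately obtain k where "mpoly_eval (f 0) a ^ k \<in> M" "mpoly_eval (f 0) a \<in> integral_closure"
    using pointwise[of a] M.ideal_set_axioms
    by (auto simp: ideal_radical_def integral_closure.genideal_iff)
  then show False using M.power_notin a(3) by blast
qed

lemma comm_ring_hom_mconst: "comm_ring_hom (mconst :: 'r::comm_ring_1 \<Rightarrow> 'r mpoly)"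
  by unfold_locales (simp_all add: single_add mult_single)

lemma (in comm_ring_hom) eval_mpoly_of_poly:
  "eval_mpoly hom a (poly (map_poly mconst p) (mvar i)) = poly (map_poly hom p) (a i)"
proof -
  interpret e: comm_ring_hom "eval_mpoly hom a" by (rule comm_ring_hom_eval_mpoly)
  interpret c: comm_ring_hom "mconst :: 'a \<Rightarrow> 'a mpoly" by (rule comm_ring_hom_mconst)
  have "map_poly (eval_mpoly hom a) (map_poly mconst p) = map_poly hom p"
    by (intro poly_eqI) (simp add: eval_mpoly_mconst)
  then show ?thesis
    using e.poly_map_poly[of "map_poly mconst p" "mvar i"] by (simp only: eval_mpoly_mvar)
qed

lemma poly_map_poly_const_var: "poly (map_poly (\<lambda>c. [:c:]) p) [:0, 1:] = (p :: 'r::comm_ring_1 poly)"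
  by (induction p) (simp_all add: map_poly_pCons)

text \<open>
  The case of one variable and \<open>f 0 = 1\<close>. The two types of polynomials are related by substituting
  the indeterminate of the one for that of the other.
\<close>

lemma radical_membership_imp_unit_ideal:
  fixes g :: "nat \<Rightarrow> 'a::idom poly"
  assumes mult: "\<And>N n (f :: nat \<Rightarrow> 'a mpoly). \<forall>j\<le>n. f j \<in> mpolys_in N \<Longrightarrow>
      \<forall>a. (\<forall>i<N. a i \<in> integral_closure) \<longrightarrow>
        mpoly_eval (f 0) a \<in> ideal_radical (ring_on integral_closure)
          (Idl\<^bsub>ring_on integral_closure\<^esub> ((\<lambda>j. mpoly_eval (f j) a) ` {1..n})) \<Longrightarrow>
      f 0 \<in> ideal_radical (ring_on (mpolys_in N)) (Idl\<^bsub>ring_on (mpolys_in N)\<^esub> (f ` {1..n}))"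
    and pointwise: "\<forall>a\<in>integral_closure.
      1 \<in> Idl\<^bsub>ring_on integral_closure\<^esub> ((\<lambda>j. upoly_eval (g j) a) ` {1..n})"
  shows "1 \<in> Idl\<^bsub>ring_of_type_algebra\<^esub> (g ` {1..n})"
proof -
  interpret S: subring_set "mpolys_in (Suc 0) :: 'a mpoly set" by (rule subring_set_mpolys_in)
  interpret R: subring_set "UNIV :: 'a poly set" by (rule subring_set_UNIV)
  interpret c: comm_ring_hom "mconst :: 'a \<Rightarrow> 'a mpoly" by (rule comm_ring_hom_mconst)
  define f where "f j = (if j = 0 then 1 else poly (map_poly mconst (g j)) (mvar 0))" for j
  have "poly (map_poly mconst (g j)) (mvar 0) \<in> mpolys_in (Suc 0)" for j
    unfolding mpolys_in_Suc
    by (intro bexI[of _ "map_poly mconst (g j)"]) (simp_all add: polys_over_def mconst_in)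
  then have "f j \<in> mpolys_in (Suc 0)" for j
    using S.one_closed by (simp add: f_def)
  moreover have "mpoly_eval (f 0) a \<in> ideal_radical (ring_on integral_closure)
          (Idl\<^bsub>ring_on integral_closure\<^esub> ((\<lambda>j. mpoly_eval (f j) a) ` {1..n}))"
    if "\<forall>i<Suc 0. a i \<in> integral_closure" for a
  proof -
    interpret e: comm_ring_hom "eval_mpoly to_closure a" by (rule to_closure.comm_ring_hom_eval_mpoly)
    have "(\<lambda>j. mpoly_eval (f j) a) ` {1..n} = (\<lambda>j. upoly_eval (g j) (a 0)) ` {1..n}"
      by (intro image_cong) (auto simp: f_def mpoly_eval_conv to_closure.eval_mpoly_of_poly upoly_eval_def)
    moreover have "mpoly_eval (f 0) a = 1" by (simp add: f_def mpoly_eval_conv)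
    ultimately show ?thesis
      using that pointwise integral_closure.one_closed by (auto simp: ideal_radical_def)
  qed
  ultimately have "f 0 \<in> ideal_radical (ring_on (mpolys_in (Suc 0))) (Idl\<^bsub>ring_on (mpolys_in (Suc 0))\<^esub> (f ` {1..n}))"
    by (intro mult) auto
  then have one: "1 \<in> Idl\<^bsub>ring_on (mpolys_in (Suc 0))\<^esub> (f ` {1..n})"
    by (auto simp: ideal_radical_def f_def)
  interpret const: comm_ring_hom "\<lambda>c :: 'a. [:c:]"
    by unfold_locales (simp_all add: one_pCons mult.commute)
  define \<psi> where "\<psi> = eval_mpoly (\<lambda>c :: 'a. [:c:]) (\<lambda>_. [:0, 1:])"
  interpret \<psi>: comm_ring_hom \<psi> unfolding \<psi>_def by (rule const.comm_ring_hom_eval_mpoly)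
  define G where "G = Idl\<^bsub>ring_on UNIV\<^esub> (g ` {1..n})"
  interpret G: ideal_set UNIV G unfolding G_def by (rule R.ideal_set_genideal) simp
  have "ideal_set (mpolys_in (Suc 0)) {p \<in> mpolys_in (Suc 0). \<psi> p \<in> G}"
    by unfold_locales (auto simp: S.closed \<psi>.hom_add \<psi>.hom_mult G.zero_mem G.add_mem G.absorb)
  moreover have "f ` {1..n} \<subseteq> {p \<in> mpolys_in (Suc 0). \<psi> p \<in> G}"
  proof -
    have "\<psi> (f j) = g j" if "j \<in> {1..n}" for j
    proof -
      have "f j = poly (map_poly mconst (g j)) (mvar 0)" using that by (simp add: f_def)
      then show ?thesis by (simp only: \<psi>_def const.eval_mpoly_of_poly poly_map_poly_const_var)
    qed
    then show ?thesis
      using R.genideal_superset[of "g ` {1..n}"] \<open>\<And>j. f j \<in> mpolys_in (Suc 0)\<close>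
      by (auto simp: G_def)
  qed
  ultimately have "1 \<in> {p \<in> mpolys_in (Suc 0). \<psi> p \<in> G}" using one S.genideal_iff by blast
  then have "1 \<in> G" by simp
  then show ?thesis by (simp add: G_def ring_on_UNIV)
qed

text \<open>
  If \<open>r X - 1\<close> is a unit modulo \<open>P\<close>, then the localization of the domain \<open>R/P\<close> at \<open>r\<close> is zero, so \<open>r\<close>
  is zero in \<open>R/P\<close>. Concretely, the coefficients of the inverse \<open>u\<close> are those of the geometric series
  \<open>- (\<Sum>k. r ^ k * X ^ k)\<close> modulo \<open>P\<close>, and beyond the degree of \<open>u\<close> they are zero.
\<close>

lemma mem_of_trivial_localization:
  assumes P: "prime_set (UNIV :: 'r::comm_ring_1 set) P"
    and one: "1 - u * [:- 1, r:] \<in> polys_over P"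
  shows "r \<in> P"
proof (rule ccontr)
  assume "r \<notin> P"
  interpret P: prime_set UNIV P by fact
  have coeff: "coeff (1 - u * [:- 1, r:]) k \<in> P" for k
    using one by (rule polys_over_coeff)
  have "coeff u k + r ^ k \<in> P" for k
  proof (induction k)
    case 0
    show ?case using coeff[of 0] by (simp add: add.commute)
  next
    case (Suc k)
    have "coeff u (Suc k) - r * coeff u k \<in> P"
      using coeff[of "Suc k"] by (simp add: mult.commute[of u] one_pCons)
    from P.add_mem[OF this P.absorb[OF _ Suc, of r]] show ?case by (simp add: algebra_simps)
  qed
  from this[of "Suc (degree u)"] have "r ^ Suc (degree u) \<in> P" by (simp add: coeff_eq_0)
  then show False using P.power_notin[OF _ \<open>r \<notin> P\<close>] by blast
qed

text \<open>
  Let \<open>P\<close> be a prime that is not the intersection of the maximal ideals above it, and \<open>r\<close> outside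
  \<open>P\<close> in all of these. The polynomial \<open>r X - 1\<close> and the finitely many generators of \<open>P\<close> satisfy the
  pointwise hypothesis: a maximal ideal \<open>M\<close> of the integral closure with all their values at \<open>a\<close>
  contracts to a maximal ideal over \<open>P\<close>, hence contains \<open>r\<close>, and then \<open>1\<close> because of \<open>a r - 1\<close>.
  But they do not generate the unit ideal.
\<close>

lemma unit_ideal_imp_jacobson:
  assumes noetherian: "noetherian_ring (ring_of_type_algebra :: 'a::idom ring)"
    and univ: "\<And>n (g :: nat \<Rightarrow> 'a poly). \<forall>a\<in>integral_closure.
      1 \<in> Idl\<^bsub>ring_on integral_closure\<^esub> ((\<lambda>j. upoly_eval (g j) a) ` {1..n}) \<Longrightarrow>
      1 \<in> Idl\<^bsub>ring_of_type_algebra\<^esub> (g ` {1..n})"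
  shows "jacobson_ring (ring_of_type_algebra :: 'a ring)"
  unfolding jacobson_ring_type_iff
proof (intro allI impI, rule ccontr)
  interpret R: subring_set "UNIV :: 'a set" by (rule subring_set_UNIV)
  interpret RX: subring_set "UNIV :: 'a poly set" by (rule subring_set_UNIV)
  fix P and r :: 'a
  assume P: "prime_set UNIV P" and "r \<notin> P"
    and none: "\<not> (\<exists>M. maximal_set UNIV M \<and> P \<subseteq> M \<and> r \<notin> M)"
  interpret P: prime_set UNIV P by fact
  have "ideal P (ring_of_type_algebra :: 'a ring)"
    using R.ideal_iff P.ideal_set_axioms by (simp add: ring_on_UNIV)
  then obtain A where A: "finite A" "P = Idl\<^bsub>ring_on UNIV\<^esub> A"
    using noetherian_ring.finetely_gen[OF noetherian] by (auto simp: ring_on_UNIV)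
  obtain xs where xs: "set xs = A" using finite_list[OF A(1)] by blast
  \<comment> \<open>The list \<open>xs\<close> is indexed from \<open>0\<close>, the generators in \<open>P\<close> from \<open>2\<close>.\<close>
  define g where "g j = (if j = 1 then [:- 1, r:] else [:xs ! (j - 2):])" for j
  define n where "n = Suc (length xs)"
  have g: "g ` {1..n} = insert [:- 1, r:] ((\<lambda>c. [:c:]) ` A)"
  proof -
    have "{1..n} = insert 1 ((\<lambda>i. i + 2) ` {..<length xs})"
      by (auto simp: n_def image_iff) (metis Suc_le_D add_2_eq_Suc' le_neq_implies_less less_Suc_eq_le nat.inject One_nat_def Suc_le_eq lessThan_iff)
    moreover have "A = (\<lambda>i. xs ! i) ` {..<length xs}"
      using xs by (auto simp: set_conv_nth)
    moreover have "g ` (\<lambda>i. i + 2) ` {..<length xs} = (\<lambda>c. [:c:]) ` (\<lambda>i. xs ! i) ` {..<length xs}"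
      unfolding image_image by (intro image_cong) (simp_all add: g_def)
    moreover have "g 1 = [:- 1, r:]" by (simp add: g_def)
    ultimately show ?thesis by (simp only: image_insert)
  qed
  have "1 \<in> Idl\<^bsub>ring_on integral_closure\<^esub> ((\<lambda>j. upoly_eval (g j) a) ` {1..n})" (is "1 \<in> ?I")
    if a: "a \<in> integral_closure" for a
  proof (rule ccontr)
    assume "1 \<notin> ?I"
    have eval: "(\<lambda>j. upoly_eval (g j) a) ` {1..n} =
        insert (a * to_closure r - 1) (to_closure ` A)"
      unfolding image_image[of "\<lambda>p. upoly_eval p a" g, symmetric] g
      by (simp add: upoly_eval_def image_image to_closure.map_poly_pCons_hom to_closure.hom_uminus)
    have "ideal_set integral_closure ?I"
      unfolding eval
      by (intro integral_closure.ideal_set_genideal)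
        (auto simp: integral_closure.closed a to_closure_integral)
    then obtain M where M: "maximal_set integral_closure M" "?I \<subseteq> M"
      using integral_closure.exists_maximal \<open>1 \<notin> ?I\<close> by blast
    interpret M: maximal_set integral_closure M by (rule M(1))
    have gens: "a * to_closure r - 1 \<in> M" "to_closure ` A \<subseteq> M"
      using integral_closure.genideal_superset[of "(\<lambda>j. upoly_eval (g j) a) ` {1..n}"] M(2)
      unfolding eval by auto
    let ?m = "{s. to_closure s \<in> M}"
    have m: "maximal_set UNIV ?m" by (rule maximal_contraction[OF M(1)])
    interpret m: maximal_set UNIV ?m by (rule m)
    have "P \<subseteq> ?m"
      using gens(2) m.ideal_set_axioms R.genideal_iff[of _ A] unfolding A(2) by blast
    then have "r \<in> ?m" using none m by blast
    then have "a * to_closure r \<in> M" using M.absorb[OF a] by simp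
    then show False using gens(1) M.mem_cong M.proper by blast
  qed
  then have "1 \<in> Idl\<^bsub>ring_on UNIV\<^esub> (g ` {1..n})" using univ[of g n] by (simp add: ring_on_UNIV)
  \<comment> \<open>The ideal generated by \<open>r X - 1\<close> and \<open>P\<close>.\<close>
  moreover have "ideal_set UNIV {h. \<exists>u. h - u * [:- 1, r:] \<in> polys_over P}" (is "ideal_set UNIV ?K")
  proof -
    interpret PX: ideal_set UNIV "polys_over P"
      using R.ideal_set_polys_over[OF P.ideal_set_axioms] by (simp add: polys_over_UNIV)
    show ?thesis
    proof
      show "0 \<in> ?K" using PX.zero_mem by (auto intro!: exI[of _ 0])
      fix x y assume "x \<in> ?K" "y \<in> ?K"
      then obtain u v where "x - u * [:- 1, r:] \<in> polys_over P" "y - v * [:- 1, r:] \<in> polys_over P"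
        by blast
      from PX.add_mem[OF this] show "x + y \<in> ?K"
        by (intro CollectI exI[of _ "u + v"]) (simp only: algebra_simps)
    next
      fix b x assume "x \<in> ?K"
      then obtain u where "x - u * [:- 1, r:] \<in> polys_over P" by blast
      from PX.absorb[OF _ this, of b] show "b * x \<in> ?K"
        by (intro CollectI exI[of _ "b * u"]) (simp only: algebra_simps UNIV_I)
    qed auto
  qed
  moreover have "g ` {1..n} \<subseteq> ?K"
  proof -
    have "[:c:] - 0 * [:- 1, r:] \<in> polys_over P" if "c \<in> A" for c
      using that R.genideal_superset[of A] P.zero_mem unfolding A(2)[symmetric]
      by (auto simp: polys_over_def coeff_pCons split: nat.split)
    moreover have "[:- 1, r:] - 1 * [:- 1, r:] \<in> polys_over P"
      using P.zero_mem by (simp add: polys_over_def)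
    ultimately show ?thesis unfolding g by blast
  qed
  ultimately have "1 \<in> ?K" using RX.genideal_iff by blast
  then obtain u where "1 - u * [:- 1, r:] \<in> polys_over P" by blast
  then show False using mem_of_trivial_localization[OF P] \<open>r \<notin> P\<close> by blast
qed

theorem corollary6p2:
  fixes R :: "'a::idom ring"
  defines "R \<equiv> ring_of_type_algebra"
  assumes "noetherian_domain R"
  shows
    "(jacobson_domain R \<longleftrightarrow>
       (\<forall>(N::nat) (n::nat) (f :: nat \<Rightarrow> 'a mpoly).
          (\<forall>j \<le> n. f j \<in> carrier (mpoly_ring N)) \<longrightarrow>
          (\<forall>a. (\<forall>i < N. a i \<in> integral_closure) \<longrightarrow>
             mpoly_eval (f 0) a \<in> ideal_radical integral_closure_ring
               (Idl\<^bsub>integral_closure_ring\<^esub> ((\<lambda>j. mpoly_eval (f j) a) ` {1..n}))) \<longrightarrow>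
          f 0 \<in> ideal_radical (mpoly_ring N) (Idl\<^bsub>mpoly_ring N\<^esub> (f ` {1..n}))))
     \<and>
     (jacobson_domain R \<longleftrightarrow>
       (\<forall>(n::nat) (f :: nat \<Rightarrow> 'a poly).
          (\<forall>a \<in> integral_closure.
             1 \<in> Idl\<^bsub>integral_closure_ring\<^esub> ((\<lambda>j. upoly_eval (f j) a) ` {1..n})) \<longrightarrow>
          1 \<in> Idl\<^bsub>ring_of_type_algebra\<^esub> (f ` {1..n})))"
    (is "(?jacobson \<longleftrightarrow> ?multivariate) \<and> (?jacobson \<longleftrightarrow> ?univariate)")
proof -
  interpret noetherian_domain R by fact
  have jacobson: "?jacobson \<longleftrightarrow> jacobson_ring R"
    using domain_axioms by (simp add: jacobson_domain_def)
  have "?multivariate" if "jacobson_ring R"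
    using jacobson_imp_radical_membership[of _ _ _] that
    unfolding R_def mpoly_ring_conv integral_closure_ring_conv ring_on_sel by blast
  moreover have "?univariate" if ?multivariate
    using that radical_membership_imp_unit_ideal
    unfolding mpoly_ring_conv integral_closure_ring_conv ring_on_sel by blast
  moreover have "jacobson_ring R" if ?univariate
    using that unit_ideal_imp_jacobson noetherian_ring_axioms
    unfolding R_def integral_closure_ring_conv by blast
  ultimately show ?thesis unfolding jacobson by blast
qed

end
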